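(* The Fourier transform $f \mapsto \tilde f$, $$\tilde f(x) = \int_{\mathbb{R}} f(\xi) e^{-ix\xi}\, d\xi, \quad x \in \mathbb{R},$$ establishes an isomorphism of the locally convex spaces $S_{\sigma}(\varphi)$ and $G_{\sigma}(\psi^* )$, i.e. it is a linear bijection of $S_{\sigma}(\varphi)$ onto $G_{\sigma}(\psi^* )$ that is continuous together with its inverse.
   Context: $\mathbb{Z}_+ = \{0,1,2,\dots\}$, and $0^0 = 1$. Fix a real number $\sigma > 0$ and a nonnegative nondecreasing continuous function $\varphi$ on $[0,\infty)$ such that: (1) $\lim_{x\to+\infty} \varphi(x)/x = +\infty$; (2) for every $h > 1$ there exists $K_h > 0$ such that $2\varphi(x) \le \varphi(hx) + K_h$ for all $x \in [0,\infty)$; (3) the function $x \mapsto \varphi(e^x)$ is convex on $[0,\infty)$. For $\varepsilon > 0$ and $k \in \mathbb{Z}_+$, $S_{\varepsilon,k}(\varphi)$ is the set of entire functions $f$ on $\mathbb{C}$ with $$p_{\varepsilon,k}(f) = \sup_{z\in\mathbb{C}} \frac{|f(z)|(1+|z|)^k}{e^{\varphi((\sigma+\varepsilon)|\mathrm{Im}\, z|)}} < \infty,$$ and $S_{\sigma}(\varphi) = \bigcap_{\varepsilon>0,\,k\in\mathbb{Z}_+} S_{\varepsilon,k}(\varphi)$, a complex vector space with the locally convex topology defined by the norms $p_{\varepsilon,k}$ ($\varepsilon>0$, $k \in \mathbb{Z}_+$). Let $\psi(x) = \varphi(e^x)$. Its Young conjugate is $\psi^*(x) = \sup_{y>0}(xy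 - \psi(y))$, $x \ge 0$ (only $y>0$ is used). For $\varepsilon > 0$ and $m \in \mathbb{Z}_+$, $G_{\varepsilon,m}(\psi^* )$ is the set of (complex-valued) $f \in C^m(\mathbb{R})$ with $$\|f\|_{\varepsilon,m} = \max_{0\le n\le m}\ \sup_{x\in\mathbb{R},\,k\in\mathbb{Z}_+} \frac{|x^k f^{(n)}(x)|}{k!\,(\sigma+\varepsilon)^k e^{-\psi^*(k)}} < \infty,$$ and $G_{\sigma}(\psi^* ) = \bigcap_{\varepsilon>0,\,m\in\mathbb{Z}_+} G_{\varepsilon,m}(\psi^* )$, a complex vector space with the locally convex topology defined by the norms $\|\cdot\|_{\varepsilon,m}$ ($\varepsilon>0$, $m\in\mathbb{Z}_+$). *)

theory Defs
  imports "HOL-Analysis.Analysis"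
begin

text \<open>
  Suprema that decide membership are taken in \<^typ>\<open>ennreal\<close>, where they always exist;
  membership is finiteness of the supremum.
\<close>

definition S_norm :: "(real \<Rightarrow> real) \<Rightarrow> real \<Rightarrow> real \<Rightarrow> nat \<Rightarrow> (complex \<Rightarrow> complex) \<Rightarrow> ennreal" where
  "S_norm \<phi> \<sigma> \<epsilon> k f =
     (SUP z. ennreal (norm (f z) * (1 + norm z) ^ k / exp (\<phi> ((\<sigma> + \<epsilon>) * \<bar>Im z\<bar>))))"

definition S_eps :: "(real \<Rightarrow> real) \<Rightarrow> real \<Rightarrow> real \<Rightarrow> nat \<Rightarrow> (complex \<Rightarrow> complex) set" where
  "S_eps \<phi> \<sigma> \<epsilon> k = {f. f holomorphic_on UNIV \<and> S_norm \<phi> \<sigma> \<epsilon> k f < \<infinity>}"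

definition S_space :: "(real \<Rightarrow> real) \<Rightarrow> real \<Rightarrow> (complex \<Rightarrow> complex) set" where
  "S_space \<phi> \<sigma> = (\<Inter>\<epsilon>\<in>{0<..}. \<Inter>k. S_eps \<phi> \<sigma> \<epsilon> k)"

definition psi :: "(real \<Rightarrow> real) \<Rightarrow> real \<Rightarrow> real" where
  "psi \<phi> x = \<phi> (exp x)"

text \<open>
  The supremum is over positive arguments only. It is a real (conditionally complete) supremum:
  for \<open>g = psi \<phi>\<close> with \<open>\<phi>\<close> superlinear at infinity and nonnegative on \<open>[0,\<infinity>)\<close>, and \<open>x \<ge> 0\<close>,
  the set is bounded above.
\<close>

definition young_conjugate :: "(real \<Rightarrow> real) \<Rightarrow> real \<Rightarrow> real" where
  "young_conjugate g x = (SUP y\<in>{0<..}. x * y - g y)"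

definition nth_derivative :: "nat \<Rightarrow> (real \<Rightarrow> complex) \<Rightarrow> real \<Rightarrow> complex" where
  "nth_derivative n f = ((\<lambda>g x. vector_derivative g (at x)) ^^ n) f"

text \<open>
  Differentiability is required explicitly, since \<^const>\<open>vector_derivative\<close> is total.
\<close>

definition C_class :: "nat \<Rightarrow> (real \<Rightarrow> complex) set" where
  "C_class m = {f. (\<forall>n<m. nth_derivative n f differentiable_on UNIV) \<and>
                   continuous_on UNIV (nth_derivative m f)}"

definition G_norm :: "(real \<Rightarrow> real) \<Rightarrow> real \<Rightarrow> real \<Rightarrow> nat \<Rightarrow> (real \<Rightarrow> complex) \<Rightarrow> ennreal" where
  "G_norm w \<sigma> \<epsilon> m f =
     (MAX n\<in>{0..m}. SUP (x, k)\<in>UNIV.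
        ennreal (norm (complex_of_real x ^ k * nth_derivative n f x) /
                 (fact k * (\<sigma> + \<epsilon>) ^ k * exp (- w (real k)))))"

definition G_eps :: "(real \<Rightarrow> real) \<Rightarrow> real \<Rightarrow> real \<Rightarrow> nat \<Rightarrow> (real \<Rightarrow> complex) set" where
  "G_eps w \<sigma> \<epsilon> m = {f \<in> C_class m. G_norm w \<sigma> \<epsilon> m f < \<infinity>}"

definition G_space :: "(real \<Rightarrow> real) \<Rightarrow> real \<Rightarrow> (real \<Rightarrow> complex) set" where
  "G_space w \<sigma> = (\<Inter>\<epsilon>\<in>{0<..}. \<Inter>m. G_eps w \<sigma> \<epsilon> m)"

text \<open>
  The locally convex topology defined on \<open>V\<close> by a family \<open>P\<close> of (semi)norms that are finite
  on \<open>V\<close>: the open balls of all members of \<open>P\<close> form a subbasis.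
\<close>

definition seminorm_topology ::
    "('a \<Rightarrow> complex) set \<Rightarrow> (('a \<Rightarrow> complex) \<Rightarrow> ennreal) set \<Rightarrow> ('a \<Rightarrow> complex) topology" where
  "seminorm_topology V P = topology_generated_by
     {{g \<in> V. p (\<lambda>x. g x - f x) < ennreal r} | p f r. p \<in> P \<and> f \<in> V \<and> 0 < r}"

definition S_topology :: "(real \<Rightarrow> real) \<Rightarrow> real \<Rightarrow> (complex \<Rightarrow> complex) topology" where
  "S_topology \<phi> \<sigma> = seminorm_topology (S_space \<phi> \<sigma>) {S_norm \<phi> \<sigma> \<epsilon> k | \<epsilon> k. 0 < \<epsilon>}"

definition G_topology :: "(real \<Rightarrow> real) \<Rightarrow> real \<Rightarrow> (real \<Rightarrow> complex) topology" where
  "G_topology w \<sigma> = seminorm_topology (G_space w \<sigma>) {G_norm w \<sigma> \<epsilon> m | \<epsilon> m. 0 < \<epsilon>}"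

definition fourier :: "(complex \<Rightarrow> complex) \<Rightarrow> real \<Rightarrow> complex" where
  "fourier f x = (LINT \<xi>|lborel. f (complex_of_real \<xi>) * exp (- \<i> * complex_of_real (x * \<xi>)))"

definition linear_on_set ::
    "('a \<Rightarrow> complex) set \<Rightarrow> (('a \<Rightarrow> complex) \<Rightarrow> ('b \<Rightarrow> complex)) \<Rightarrow> bool" where
  "linear_on_set V F \<longleftrightarrow>
     (\<forall>f\<in>V. \<forall>g\<in>V. F (\<lambda>x. f x + g x) = (\<lambda>x. F f x + F g x)) \<and>
     (\<forall>f\<in>V. \<forall>c. F (\<lambda>x. c * f x) = (\<lambda>x. c * F f x))"

end

theory Submission
  imports Defs "HOL-Probability.Characteristic_Functions" "HOL-Probability.Sinc_Integral"
    "HOL-Complex_Analysis.Complex_Analysis"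
begin

text \<open>
  Write \<open>\<psi>*\<close> for the Young conjugate of \<open>\<psi>(y) = \<phi>(e\<^sup>y)\<close>. Both inclusions rest on the same duality between
  the factors \<open>k! s\<^sup>k e\<^bsup>-\<psi>*(k)\<^esup>\<close> and the growth \<open>e\<^bsup>\<phi>(s t)\<^esup>\<close>: substituting \<open>s t = e\<^sup>y\<close> in the definition
  of the conjugate gives \<open>s\<^sup>k e\<^bsup>-\<psi>*(k)\<^esup> = inf t\<^bsup>-k\<^esup> e\<^bsup>\<phi>(s t)\<^esup>\<close>, the infimum being over \<open>s t > 1\<close>.

  From \<open>S\<close> to \<open>G\<close>. For \<open>f\<close> in \<open>S\<close> the line of integration of the \<open>n\<close>-th derivative of the transform can be
  moved to height \<open>t\<close>, above or below the real axis according to the sign of \<open>x\<close>. This bounds that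
  derivative by a constant times \<open>e\<^bsup>\<phi>((\<sigma>+\<epsilon>)t) - \<bar>x\<bar>t\<^esup>\<close> for every \<open>t > 0\<close>. Since \<open>(\<bar>x\<bar>t)\<^sup>k \<le> k! e\<^bsup>\<bar>x\<bar>t\<^esup>\<close>, multiplying
  by \<open>\<bar>x\<bar>\<^sup>k\<close> leaves \<open>k! t\<^bsup>-k\<^esup> e\<^bsup>\<phi>((\<sigma>+\<epsilon>)t)\<^esup>\<close>, and the infimum over \<open>t\<close> is the weight of the norms of \<open>G\<close>
  (\<open>fourier_moment_estimate\<close>).

  From \<open>G\<close> to \<open>S\<close>. The inverse transform of \<open>g\<close> is \<open>z \<mapsto> (1/2\<pi>) \<integral> g(x) e\<^bsup>ixz\<^esup> dx\<close>. Integration by parts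
  turns multiplication by powers of \<open>z\<close> into differentiation of \<open>g\<close>, so it suffices to bound
  \<open>\<bar>g\<^bsup>(n)\<^esup>(x)\<bar> e\<^bsup>\<bar>x\<bar>t\<^esup>\<close> with \<open>t = \<bar>Im z\<bar>\<close>, uniformly up to an integrable factor. Expanding \<open>e\<^bsup>\<bar>x\<bar>t\<^esup>\<close> in its
  power series, the \<open>k\<close>-th term is, up to a factor polynomial in \<open>k\<close>, at most \<open>(s t)\<^sup>k e\<^bsup>-\<psi>*(k)\<^esup>\<close>, and
  the duality, used with the slightly larger argument \<open>h s t\<close> where \<open>h > 1\<close>, bounds this by \<open>h\<^bsup>-k\<^esup> e\<^bsup>\<phi>(h s t)\<^esup>\<close> up to a constant. The
  geometric factor makes the series converge, and the loss of \<open>h\<close> is harmless because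
  \<open>\<epsilon>\<close> is arbitrary (\<open>exp_neg_young_le\<close>, \<open>exp_weighted_decay\<close>). The same series, integrated term by term,
  is a power series in \<open>z\<close>, which shows that the inverse transform is entire.

  The two maps are inverse to each other by the Fourier inversion formula on the real line
  (\<open>fourier_inversion\<close>) and the identity theorem. Every estimate above is linear in the norm of the
  argument, so it also gives continuity in both directions (\<open>continuous_map_seminorm_topology\<close>).
\<close>

section \<open>Integrals of functions with quadratic decay\<close>

lemma has_bochner_integral_inverse_1_plus_square:
  "has_bochner_integral lborel (\<lambda>x::real. 1 / (1 + x\<^sup>2)) pi"
  using integrable_inverse_1_plus_square LBINT_inverse_1_plus_square
  by (simp add: has_bochner_integral_iff set_integrable_def interval_lebesgue_integral_def
      set_lebesgue_integral_def inverse_eq_divide)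

lemma decay_imp_norm_le:
  fixes v :: "'a::real_normed_vector" and x C :: real
  assumes "norm v * (1 + x\<^sup>2) \<le> C"
  shows "norm v \<le> C * (1 / (1 + x\<^sup>2))"
proof -
  have "0 < 1 + x\<^sup>2"
    by (simp add: add_pos_nonneg)
  with assms show ?thesis
    by (simp add: field_simps)
qed

text \<open>
  Elements of both spaces, and their products with the Fourier kernel, are integrated by comparison with
  \<open>1 / (1 + x\<^sup>2)\<close>, whose integral is \<open>\<pi>\<close>. The bound is in multiplied-out form because the weighted
  estimates deliver it so.
\<close>

lemma quadratic_decay_integral:
  fixes h :: "real \<Rightarrow> 'a::{banach, second_countable_topology}"
  assumes cont: "continuous_on UNIV h"
    and decay: "\<And>x. norm (h x) * (1 + x\<^sup>2) \<le> C"
  shows "integrable lborel h" and "norm (LINT x|lborel. h x) \<le> pi * C"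
proof -
  have int: "integrable lborel (\<lambda>x::real. C * (1 / (1 + x\<^sup>2)))"
    and val: "(LINT x|lborel. C * (1 / (1 + x\<^sup>2))) = pi * C"
    using has_bochner_integral_mult_right[OF has_bochner_integral_inverse_1_plus_square, of C]
    by (simp_all only: has_bochner_integral_iff mult.commute[of C pi])
  have meas: "h \<in> borel_measurable lborel"
    using cont by (simp add: borel_measurable_continuous_onI)
  show I: "integrable lborel h"
  proof (rule Bochner_Integration.integrable_bound[OF int meas])
    show "AE x in lborel. norm (h x) \<le> norm (C * (1 / (1 + x\<^sup>2)))"
    proof (rule AE_I2)
      show "norm (h x) \<le> norm (C * (1 / (1 + x\<^sup>2)))" for x
        using decay_imp_norm_le[OF decay[of x]] abs_ge_self order_trans unfolding real_norm_def
        by blast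
    qed
  qed
  have "norm (LINT x|lborel. h x) \<le> (LINT x|lborel. C * (1 / (1 + x\<^sup>2)))"
    by (rule Bochner_Integration.integral_norm_bound_integral[OF I int])
       (rule decay_imp_norm_le[OF decay])
  with val show "norm (LINT x|lborel. h x) \<le> pi * C"
    by simp
qed

lemma quadratic_decay_tendsto_0:
  fixes H :: "real \<Rightarrow> complex"
  assumes "\<And>x. norm (H x) * (1 + x\<^sup>2) \<le> C"
  shows "(H \<longlongrightarrow> 0) at_top" and "(H \<longlongrightarrow> 0) at_bot"
proof -
  have le: "\<forall>\<^sub>F x in F. norm (H x) \<le> C * (1 / (1 + x\<^sup>2))" for F
    by (intro always_eventually allI decay_imp_norm_le assms)
  have "((\<lambda>x::real. C * (1 / (1 + x\<^sup>2))) \<longlongrightarrow> 0) at_top"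
    by real_asymp
  then show "(H \<longlongrightarrow> 0) at_top"
    by (rule Lim_null_comparison[OF le])
  have "((\<lambda>x::real. C * (1 / (1 + x\<^sup>2))) \<longlongrightarrow> 0) at_bot"
    by real_asymp
  then show "(H \<longlongrightarrow> 0) at_bot"
    by (rule Lim_null_comparison[OF le])
qed

text \<open>
  The fundamental theorem of calculus on the whole line. It serves both for integration by parts and,
  below, for moving the line of integration.
\<close>

lemma integral_derivative_eq_0:
  fixes H h :: "real \<Rightarrow> complex"
  assumes deriv: "\<And>x. (H has_vector_derivative h x) (at x)"
    and cont: "continuous_on UNIV h"
    and h: "\<And>x. norm (h x) * (1 + x\<^sup>2) \<le> C"
    and H: "\<And>x. norm (H x) * (1 + x\<^sup>2) \<le> D"
  shows "(LINT x|lborel. h x) = 0"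
proof -
  have "(LBINT x=-\<infinity>..\<infinity>. h x) = 0 - 0"
  proof (rule interval_integral_FTC_integrable[where F = H])
    show "set_integrable lborel (einterval (-\<infinity>) \<infinity>) h"
      using quadratic_decay_integral(1)[OF cont h] by (simp add: set_integrable_def)
    show "isCont h x" for x
      using cont by (simp add: continuous_on_eq_continuous_at)
    show "((H \<circ> real_of_ereal) \<longlongrightarrow> 0) (at_right (-\<infinity>))"
         "((H \<circ> real_of_ereal) \<longlongrightarrow> 0) (at_left \<infinity>)"
      using quadratic_decay_tendsto_0[OF H] by (simp_all add: ereal_tendsto_simps)
  qed (use deriv in auto)
  then show ?thesis
    by (simp add: interval_lebesgue_integral_def set_lebesgue_integral_def)
qed

text \<open>
  Moving the line of integration needs no contour: if \<open>P\<close> is a primitive of \<open>h\<close>, then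
  \<open>x \<mapsto> P (x + it) - P x\<close> is a primitive of the difference of the two integrands, and it
  vanishes at infinity because \<open>h\<close> is small on the vertical segment from \<open>x\<close> to \<open>x + it\<close>.
\<close>

lemma integral_horizontal_line_shift:
  fixes h :: "complex \<Rightarrow> complex" and t :: real
  assumes hol: "h holomorphic_on UNIV"
    and decay: "\<And>z. \<bar>Im z\<bar> \<le> \<bar>t\<bar> \<Longrightarrow> norm (h z) * (1 + (Re z)\<^sup>2) \<le> C"
  shows "(LINT x|lborel. h (Complex x t)) = (LINT x|lborel. h (of_real x))"
proof -
  obtain P where P: "\<And>z. (P has_field_derivative h z) (at z)"
    using holomorphic_convex_primitive'[OF convex_UNIV open_UNIV hol] by auto
  have line: "Complex x s = of_real x + \<i> * of_real s" for x s
    by (simp add: complex_eq_iff)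
  have conth: "continuous_on UNIV (\<lambda>x. h (Complex x s))" for s
    unfolding line
    by (intro continuous_on_compose2[OF holomorphic_on_imp_continuous_on[OF hol]]
        continuous_intros) auto
  have dec: "norm (h (Complex x s)) * (1 + x\<^sup>2) \<le> C" if "\<bar>s\<bar> \<le> \<bar>t\<bar>" for x s
    using decay[of "Complex x s"] that by simp
  have int: "integrable lborel (\<lambda>x. h (Complex x s))" if "\<bar>s\<bar> \<le> \<bar>t\<bar>" for s
    by (rule quadratic_decay_integral(1)[OF conth dec[OF that]])
  have deriv: "((\<lambda>x. P (Complex x s)) has_vector_derivative h (Complex x s)) (at x)" for x s
  proof -
    have "((\<lambda>x. of_real x + \<i> * of_real s) has_vector_derivative 1) (at x)"
      by (auto intro!: derivative_eq_intros)
    from field_vector_diff_chain_at[OF this P] show ?thesis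
      by (simp add: o_def line)
  qed
  have "(LINT x|lborel. h (Complex x t) - h (Complex x 0)) = 0"
  proof (rule integral_derivative_eq_0[where H = "\<lambda>x. P (Complex x t) - P (Complex x 0)"])
    show "((\<lambda>x. P (Complex x t) - P (Complex x 0)) has_vector_derivative
            h (Complex x t) - h (Complex x 0)) (at x)" for x
      by (intro has_vector_derivative_diff deriv)
    show "continuous_on UNIV (\<lambda>x. h (Complex x t) - h (Complex x 0))"
      by (intro continuous_on_diff conth)
    show "norm (h (Complex x t) - h (Complex x 0)) * (1 + x\<^sup>2) \<le> 2 * C" for x
    proof -
      have "norm (h (Complex x t) - h (Complex x 0)) * (1 + x\<^sup>2)
          \<le> (norm (h (Complex x t)) + norm (h (Complex x 0))) * (1 + x\<^sup>2)"
        by (intro mult_right_mono norm_triangle_ineq4) simp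
      with dec[of t x] dec[of 0 x] show ?thesis
        by (simp add: distrib_right)
    qed
    show "norm (P (Complex x t) - P (Complex x 0)) * (1 + x\<^sup>2) \<le> C * \<bar>t\<bar>" for x
    proof -
      have pos: "0 < 1 + x\<^sup>2"
        by (simp add: add_pos_nonneg)
      define S where "S = {z. Re z = x \<and> \<bar>Im z\<bar> \<le> \<bar>t\<bar>}"
      have "S = {z. Re z \<le> x} \<inter> {z. Re z \<ge> x} \<inter> {z. Im z \<le> \<bar>t\<bar>} \<inter> {z. Im z \<ge> - \<bar>t\<bar>}"
        by (auto simp: S_def)
      then have "convex S"
        by (metis convex_Int convex_halfspace_Re_le convex_halfspace_Re_ge
            convex_halfspace_Im_le convex_halfspace_Im_ge)
      then have "norm (P (Complex x t) - P (Complex x 0)) \<le>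
          (C * (1 / (1 + x\<^sup>2))) * norm (Complex x t - Complex x 0)"
      proof (rule field_differentiable_bound)
        show "(P has_field_derivative h z) (at z within S)" for z
          using P has_field_derivative_at_within by blast
        show "norm (h z) \<le> C * (1 / (1 + x\<^sup>2))" if "z \<in> S" for z
          using decay[of z] that by (intro decay_imp_norm_le) (simp add: S_def)
      qed (auto simp: S_def)
      moreover have "norm (Complex x t - Complex x 0) = \<bar>t\<bar>"
        by (simp add: cmod_def)
      ultimately show ?thesis
        using pos by (simp add: field_simps)
    qed
  qed
  moreover have "h (Complex x 0) = h (of_real x)" for x
    by (simp add: complex_of_real_def)
  ultimately show ?thesis
    using int[of t] int[of 0] by simp
qed

section \<open>Entire functions and Fourier integrals\<close>

lemma entire_eqI_real:
  assumes "f holomorphic_on UNIV" "g holomorphic_on UNIV"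
    and eq: "\<And>x. f (complex_of_real x) = g (of_real x)"
  shows "f = g"
proof
  fix z :: complex
  have lim: "(0::complex) islimpt range of_real"
    unfolding islimpt_sequential
  proof (intro exI conjI allI)
    show "complex_of_real (1 / real (Suc n)) \<in> range of_real - {0}" for n
      by (intro DiffI rangeI) (simp only: singleton_iff of_real_eq_0_iff, simp)
    have "(\<lambda>n. complex_of_real (1 / real (Suc n))) \<longlonglongrightarrow> of_real 0"
      by (intro tendsto_of_real LIMSEQ_inverse_real_of_nat[unfolded inverse_eq_divide])
    then show "(\<lambda>n. complex_of_real (1 / real (Suc n))) \<longlonglongrightarrow> 0"
      by simp
  qed
  have "f z - g z = 0"
    by (rule analytic_continuation[of "\<lambda>z. f z - g z" UNIV "range of_real" 0])
       (use assms lim in \<open>auto intro!: holomorphic_on_diff\<close>)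
  then show "f z = g z"
    by simp
qed

lemma norm_iexp_minus_linear_le: "norm (iexp y - 1 - \<i> * of_real y) \<le> y\<^sup>2"
proof -
  have "norm (iexp y - (1 + \<i> * of_real y)) \<le> y\<^sup>2 / 2"
    using iexp_approx1[of y 1] by (simp add: eval_nat_numeral)
  then show ?thesis
    by (simp add: diff_diff_eq) (smt (verit) zero_le_power2 field_sum_of_halves)
qed

text \<open>
  The second moment controls the remainder in the first-order expansion of the kernel uniformly, so
  the error of the difference quotient is linear in the increment.
\<close>

lemma has_vector_derivative_fourier_integral:
  fixes u :: "real \<Rightarrow> complex"
  assumes i0: "integrable lborel u"
    and i1: "integrable lborel (\<lambda>\<xi>. of_real \<xi> * u \<xi>)"
    and i2: "integrable lborel (\<lambda>\<xi>. of_real \<xi> ^ 2 * u \<xi>)"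
  shows "((\<lambda>x. LINT \<xi>|lborel. u \<xi> * iexp (- (x * \<xi>))) has_vector_derivative
           (LINT \<xi>|lborel. (- \<i> * of_real \<xi>) * u \<xi> * iexp (- (x * \<xi>)))) (at x)"
proof -
  define F where "F x = (LINT \<xi>|lborel. u \<xi> * iexp (- (x * \<xi>)))" for x
  define D where "D = (LINT \<xi>|lborel. (- \<i> * of_real \<xi>) * u \<xi> * iexp (- (x * \<xi>)))"
  define M where "M = (LINT \<xi>|lborel. norm (of_real \<xi> ^ 2 * u \<xi>))"
  have intF: "integrable lborel (\<lambda>\<xi>. u \<xi> * iexp (- (x * \<xi>)))" for x
    by (rule Bochner_Integration.integrable_bound[OF i0])
       (use i0 in \<open>auto simp: norm_mult\<close>)
  have intD: "integrable lborel (\<lambda>\<xi>. (- \<i> * of_real \<xi>) * u \<xi> * iexp (- (x * \<xi>)))"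
    by (rule Bochner_Integration.integrable_bound[OF i1])
       (use i0 in \<open>auto simp: norm_mult\<close>)
  have remainder: "norm (F (x + s) - F x - s *\<^sub>R D) \<le> s\<^sup>2 * M" for s
  proof -
    define R where "R \<xi> = u \<xi> * iexp (- ((x + s) * \<xi>)) - u \<xi> * iexp (- (x * \<xi>))
        - of_real s * ((- \<i> * of_real \<xi>) * u \<xi> * iexp (- (x * \<xi>)))" for \<xi>
    have R: "integrable lborel R"
      unfolding R_def by (intro Bochner_Integration.integrable_diff intF integrable_mult_right intD)
    have "F (x + s) - F x - s *\<^sub>R D = (LINT \<xi>|lborel. R \<xi>)"
      unfolding F_def D_def R_def scaleR_conv_of_real
      by (simp only: Bochner_Integration.integral_diff Bochner_Integration.integrable_diff
          intF intD integrable_mult_right integral_mult_right_zero)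
    also have "norm \<dots> \<le> (LINT \<xi>|lborel. s\<^sup>2 * norm (of_real \<xi> ^ 2 * u \<xi>))"
    proof (rule Bochner_Integration.integral_norm_bound_integral[OF R])
      show "integrable lborel (\<lambda>\<xi>. s\<^sup>2 * norm (of_real \<xi> ^ 2 * u \<xi>))"
        using i2 by (intro integrable_mult_right integrable_norm)
      fix \<xi> :: real
      have "R \<xi> = u \<xi> * iexp (- (x * \<xi>)) * (iexp (- (s * \<xi>)) - 1 - \<i> * of_real (- (s * \<xi>)))"
        by (simp add: R_def algebra_simps exp_add[symmetric])
      then have "norm (R \<xi>) \<le> norm (u \<xi>) * (s * \<xi>)\<^sup>2"
        using mult_left_mono[OF norm_iexp_minus_linear_le[of "- (s * \<xi>)"] norm_ge_zero[of "u \<xi>"]]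
        by (simp add: norm_mult)
      then show "norm (R \<xi>) \<le> s\<^sup>2 * norm (of_real \<xi> ^ 2 * u \<xi>)"
        by (simp add: norm_mult norm_power power_mult_distrib mult_ac)
    qed
    finally show ?thesis
      by (simp add: M_def)
  qed
  have "((\<lambda>s. norm (F (x + s) - F x - s *\<^sub>R D) / norm s) \<longlongrightarrow> 0) (at 0)"
  proof (rule Lim_null_comparison)
    show "\<forall>\<^sub>F s in at 0. norm (norm (F (x + s) - F x - s *\<^sub>R D) / norm s) \<le> \<bar>s\<bar> * M"
    proof (rule eventually_at_filter[THEN iffD2], intro always_eventually allI impI)
      fix s :: real assume "s \<noteq> 0"
      then show "norm (norm (F (x + s) - F x - s *\<^sub>R D) / norm s) \<le> \<bar>s\<bar> * M"
        using remainder[of s] by (simp add: field_simps power2_eq_square abs_mult_self_eq)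
    qed
    have "((\<lambda>s. \<bar>s\<bar> * M) \<longlongrightarrow> \<bar>0\<bar> * M) (at 0)"
      by (intro tendsto_intros)
    then show "((\<lambda>s. \<bar>s\<bar> * M) \<longlongrightarrow> 0) (at 0)"
      by simp
  qed
  then have "(F has_vector_derivative D) (at x)"
    by (simp add: has_vector_derivative_def has_derivative_at bounded_linear_scaleR_left)
  then show ?thesis
    unfolding F_def D_def .
qed

text \<open>
  This is the characteristic function of the normal distribution, rescaled.
\<close>

lemma integral_gaussian_iexp:
  fixes c t :: real
  assumes "c > 0"
  shows "(LINT y|lborel. std_normal_density (c * y) *\<^sub>R iexp (t * y)) =
         of_real (exp (- (t / c)\<^sup>2 / 2) / c)"
proof -
  have "of_real (exp (- (t / c)\<^sup>2 / 2)) = char std_normal_distribution (t / c)"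
    by (simp add: char_std_normal_distribution)
  also have "\<dots> = (LINT v|lborel. std_normal_density v *\<^sub>R iexp (t / c * v))"
    unfolding char_def by (subst integral_density) auto
  also have "\<dots> = c *\<^sub>R (LINT y|lborel. std_normal_density (c * y) *\<^sub>R iexp (t * y))"
    using assms by (subst lborel_integral_real_affine[of c _ 0]) auto
  finally show ?thesis
    using assms by (simp add: scaleR_conv_of_real field_simps)
qed

text \<open>
  Gaussian summability. Inserting the factor \<open>exp (- (c y)\<^sup>2 / 2)\<close> into the outer integral makes the
  double integral absolutely convergent, and Fubini's theorem turns it into the integral of
  \<open>h (a + c u)\<close> against a fixed Gaussian in \<open>u\<close>. Both sides converge as \<open>c\<close> tends to \<open>0\<close>, by dominated
  convergence: the left because the transform is integrable, the right because \<open>h\<close> is bounded and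
  continuous.
\<close>

theorem fourier_inversion:
  fixes h :: "real \<Rightarrow> complex"
  assumes cont: "continuous_on UNIV h"
    and int: "integrable lborel h"
    and bdd: "\<And>x. norm (h x) \<le> B"
    and int_hat: "integrable lborel (\<lambda>y. LINT x|lborel. h x * iexp (- (x * y)))"
  shows "(LINT y|lborel. (LINT x|lborel. h x * iexp (- (x * y))) * iexp (a * y)) = 2 * pi * h a"
proof -
  define hh where "hh y = (LINT x|lborel. h x * iexp (- (x * y)))" for y
  define c where "c n = 1 / real (Suc n)" for n
  have c_pos: "c n > 0" for n
    by (simp add: c_def)
  have c_lim: "c \<longlonglongrightarrow> 0"
    unfolding c_def by real_asymp
  have [measurable]: "h \<in> borel_measurable borel"
    using int by auto
  have hh_meas [measurable]: "hh \<in> borel_measurable borel"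
    using int_hat unfolding hh_def by auto
  have gauss_int: "integrable lborel std_normal_density"
    by (simp add: integrable_normal_density)
  have dens: "exp (- u\<^sup>2 / 2) = sqrt (2 * pi) * std_normal_density u" for u
    by (simp add: std_normal_density_def)
  have dens_le: "std_normal_density u \<le> 1" for u
  proof -
    have "1 \<le> sqrt (2 * pi)"
      using pi_ge_two by simp
    moreover have "exp (- u\<^sup>2 / 2) \<le> 1"
      by simp
    ultimately have "exp (- u\<^sup>2 / 2) \<le> sqrt (2 * pi)"
      by (rule order_trans[rotated])
    then have "exp (- u\<^sup>2 / 2) / sqrt (2 * pi) \<le> 1"
      by (subst divide_le_eq_1) auto
    then show ?thesis
      unfolding std_normal_density_def by simp
  qed
  have smoothed: "(LINT y|lborel. std_normal_density (c n * y) *\<^sub>R (hh y * iexp (a * y))) =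
      (LINT u|lborel. exp (- u\<^sup>2 / 2) *\<^sub>R h (a + c n * u))" for n
  proof -
    note cn = c_pos[of n]
    define k where "k x y = h x * (std_normal_density (c n * y) *\<^sub>R iexp ((a - x) * y))" for x y
    have gint: "integrable lborel (\<lambda>y. std_normal_density (c n * y))"
      using lborel_integrable_real_affine[OF gauss_int, of "c n" 0] cn by simp
    have nk: "norm (k x y) = norm (h x) * std_normal_density (c n * y)" for x y
      by (simp add: k_def norm_mult)
    have "integrable (lborel \<Otimes>\<^sub>M lborel) (case_prod k)"
    proof (rule lborel_pair.Fubini_integrable)
      show "case_prod k \<in> borel_measurable (lborel \<Otimes>\<^sub>M lborel)"
        unfolding k_def by measurable
      show "integrable lborel (\<lambda>x. LINT y|lborel. norm (case_prod k (x, y)))"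
        using int by (simp add: nk)
      show "AE x in lborel. integrable lborel (\<lambda>y. case_prod k (x, y))"
      proof (intro AE_I2)
        fix x :: real
        show "integrable lborel (\<lambda>y. case_prod k (x, y))"
          by (rule Bochner_Integration.integrable_bound[OF integrable_mult_right[OF gint, of "norm (h x)"]])
             (auto simp: nk, auto simp: k_def)
      qed
    qed
    then have swap: "(LINT y|lborel. LINT x|lborel. k x y) = (LINT x|lborel. LINT y|lborel. k x y)"
      by (rule lborel_pair.Fubini_integral)
    have "(LINT x|lborel. k x y) = std_normal_density (c n * y) *\<^sub>R (hh y * iexp (a * y))" for y
    proof -
      have "k x y = (h x * iexp (- (x * y))) * (std_normal_density (c n * y) *\<^sub>R iexp (a * y))" for x
        by (simp add: k_def scaleR_conv_of_real algebra_simps exp_add[symmetric])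
      then show ?thesis
        by (simp add: hh_def)
    qed
    then have "(LINT y|lborel. std_normal_density (c n * y) *\<^sub>R (hh y * iexp (a * y))) =
        (LINT x|lborel. LINT y|lborel. k x y)"
      using swap by simp
    also have "\<dots> = (LINT x|lborel. h x * of_real (exp (- ((a - x) / c n)\<^sup>2 / 2) / c n))"
      unfolding k_def by (simp only: integral_mult_right_zero integral_gaussian_iexp[OF cn])
    also have "\<dots> = (LINT u|lborel. exp (- u\<^sup>2 / 2) *\<^sub>R h (a + c n * u))"
      using cn by (subst lborel_integral_real_affine[of "c n" _ a])
        (simp_all add: scaleR_conv_of_real mult.commute)
    finally show ?thesis .
  qed
  have lim_left: "(\<lambda>n. LINT y|lborel. std_normal_density (c n * y) *\<^sub>R (hh y * iexp (a * y)))
      \<longlonglongrightarrow> (LINT y|lborel. std_normal_density 0 *\<^sub>R (hh y * iexp (a * y)))"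
  proof (rule integral_dominated_convergence[where w = "\<lambda>y. norm (hh y)"])
    show "integrable lborel (\<lambda>y. norm (hh y))"
      using int_hat unfolding hh_def by (rule integrable_norm)
    show "AE y in lborel. (\<lambda>n. std_normal_density (c n * y) *\<^sub>R (hh y * iexp (a * y)))
        \<longlonglongrightarrow> std_normal_density 0 *\<^sub>R (hh y * iexp (a * y))"
    proof (intro AE_I2 tendsto_scaleR tendsto_const)
      fix y :: real
      have "isCont std_normal_density (0 * y)"
        unfolding std_normal_density_def by (intro continuous_intros) auto
      moreover have "(\<lambda>n. c n * y) \<longlonglongrightarrow> 0 * y"
        by (intro tendsto_mult c_lim tendsto_const)
      ultimately show "(\<lambda>n. std_normal_density (c n * y)) \<longlonglongrightarrow> std_normal_density 0"
        using isCont_tendsto_compose by fastforce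
    qed
    show "AE y in lborel. norm (std_normal_density (c n * y) *\<^sub>R (hh y * iexp (a * y))) \<le> norm (hh y)" for n
      using dens_le by (auto simp: norm_mult intro!: AE_I2 mult_left_le_one_le)
  qed measurable
  have lim_right: "(\<lambda>n. LINT u|lborel. exp (- u\<^sup>2 / 2) *\<^sub>R h (a + c n * u))
      \<longlonglongrightarrow> (LINT u|lborel. exp (- u\<^sup>2 / 2) *\<^sub>R h a)"
  proof (rule integral_dominated_convergence[where w = "\<lambda>u. exp (- u\<^sup>2 / 2) * B"])
    show "integrable lborel (\<lambda>u. exp (- u\<^sup>2 / 2) * B)"
      unfolding dens using gauss_int by simp
    show "AE u in lborel. (\<lambda>n. exp (- u\<^sup>2 / 2) *\<^sub>R h (a + c n * u)) \<longlonglongrightarrow> exp (- u\<^sup>2 / 2) *\<^sub>R h a"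
    proof (intro AE_I2 tendsto_scaleR tendsto_const)
      fix u :: real
      have "isCont h (a + 0 * u)"
        using cont by (simp add: continuous_on_eq_continuous_at)
      moreover have "(\<lambda>n. a + c n * u) \<longlonglongrightarrow> a + 0 * u"
        by (intro tendsto_intros c_lim)
      ultimately show "(\<lambda>n. h (a + c n * u)) \<longlonglongrightarrow> h a"
        using isCont_tendsto_compose by fastforce
    qed
    show "AE u in lborel. norm (exp (- u\<^sup>2 / 2) *\<^sub>R h (a + c n * u)) \<le> exp (- u\<^sup>2 / 2) * B" for n
      using bdd by (auto intro!: AE_I2 mult_left_mono)
  qed measurable
  have "(LINT y|lborel. std_normal_density 0 *\<^sub>R (hh y * iexp (a * y))) =
      (LINT u|lborel. exp (- u\<^sup>2 / 2) *\<^sub>R h a)"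
    using LIMSEQ_unique[OF lim_left[unfolded smoothed] lim_right] .
  also have "\<dots> = (LINT u|lborel. exp (- u\<^sup>2 / 2)) *\<^sub>R h a"
    by (rule integral_scaleR_left) (unfold dens, rule integrable_mult_right[OF gauss_int])
  also have "(LINT u|lborel. exp (- u\<^sup>2 / 2)) = sqrt (2 * pi)"
    unfolding dens by (simp add: integral_normal_density)
  finally have "(1 / sqrt (2 * pi)) *\<^sub>R (LINT y|lborel. hh y * iexp (a * y)) = sqrt (2 * pi) *\<^sub>R h a"
    by (simp add: std_normal_density_def)
  then have "sqrt (2 * pi) *\<^sub>R (1 / sqrt (2 * pi)) *\<^sub>R (LINT y|lborel. hh y * iexp (a * y)) =
      sqrt (2 * pi) *\<^sub>R sqrt (2 * pi) *\<^sub>R h a"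
    by simp
  then have "(LINT y|lborel. hh y * iexp (a * y)) = 2 * pi * h a"
    by (simp add: scaleR_conv_of_real mult.assoc[symmetric] flip: of_real_mult)
  then show ?thesis
    by (simp add: hh_def)
qed

section \<open>Continuity for topologies generated by seminorms\<close>

text \<open>
  The usual criterion for linear maps between locally convex spaces. Membership of \<open>F g\<close> in a ball
  around an arbitrary centre follows from the triangle inequality once \<open>F g\<close> is close to \<open>F h\<close>. The
  norms take values in the extended nonnegative reals, so their axioms are assumed one by one and only
  on the given spaces.
\<close>

lemma continuous_map_seminorm_topology:
  fixes F :: "('a \<Rightarrow> complex) \<Rightarrow> ('b \<Rightarrow> complex)"
  assumes maps: "F ` V \<subseteq> W"
    and V_diff: "\<And>f g. f \<in> V \<Longrightarrow> g \<in> V \<Longrightarrow> (\<lambda>x. f x - g x) \<in> V"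
    and F_diff: "\<And>f g. f \<in> V \<Longrightarrow> g \<in> V \<Longrightarrow> F (\<lambda>x. f x - g x) = (\<lambda>y. F f y - F g y)"
    and P0: "\<And>p. p \<in> P \<Longrightarrow> p (\<lambda>_. 0) = 0"
    and Q0: "\<And>q. q \<in> Q \<Longrightarrow> q (\<lambda>_. 0) = 0" and "Q \<noteq> {}"
    and Q_triangle: "\<And>q a b c. q \<in> Q \<Longrightarrow> a \<in> W \<Longrightarrow> b \<in> W \<Longrightarrow> c \<in> W \<Longrightarrow>
        q (\<lambda>y. a y - c y) \<le> q (\<lambda>y. a y - b y) + q (\<lambda>y. b y - c y)"
    and bound: "\<And>q. q \<in> Q \<Longrightarrow> \<exists>p\<in>P. \<exists>C\<ge>0. \<forall>f\<in>V. q (F f) \<le> ennreal C * p f"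
  shows "continuous_map (seminorm_topology V P) (seminorm_topology W Q) F"
proof -
  let ?T = "seminorm_topology V P"
  have top_V: "topspace ?T \<subseteq> V"
    unfolding seminorm_topology_def topology_generated_by_topspace by auto
  have ball_open: "openin ?T {g \<in> V. p (\<lambda>x. g x - f x) < ennreal r}"
    if "p \<in> P" "f \<in> V" "0 < r" for p f r
    unfolding seminorm_topology_def using that by (intro topology_generated_by_Basis) blast
  show ?thesis
    unfolding seminorm_topology_def[of W Q]
  proof (rule continuous_on_generated_topo)
    fix U assume "U \<in> {{g \<in> W. p (\<lambda>x. g x - f x) < ennreal r} |p f r. p \<in> Q \<and> f \<in> W \<and> 0 < r}"
    then obtain q f0 r where U: "U = {g \<in> W. q (\<lambda>y. g y - f0 y) < ennreal r}"
      and q: "q \<in> Q" and f0: "f0 \<in> W" and r: "0 < r"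
      by blast
    obtain p C where p: "p \<in> P" and C: "C \<ge> 0"
      and pC: "\<And>f. f \<in> V \<Longrightarrow> q (F f) \<le> ennreal C * p f"
      using bound[OF q] by blast
    show "openin ?T (F -` U \<inter> topspace ?T)"
    proof (subst openin_subopen, intro ballI)
      fix h assume "h \<in> F -` U \<inter> topspace ?T"
      then have h: "h \<in> V" and hU: "q (\<lambda>y. F h y - f0 y) < ennreal r"
        using top_V U by auto
      define d where "d = enn2real (q (\<lambda>y. F h y - f0 y))"
      have d: "q (\<lambda>y. F h y - f0 y) = ennreal d"
        unfolding d_def using order.strict_trans[OF hU ennreal_less_top] by simp
      have d0: "d \<ge> 0"
        by (simp add: d_def)
      then have dr: "d < r"
        using hU unfolding d by (simp add: ennreal_less_iff)
      \<comment> \<open>Dividing by \<^term>\<open>C + 1\<close> rather than \<^term>\<open>C\<close> covers the case \<^term>\<open>C = 0\<close>.\<close>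
      define \<delta> where "\<delta> = (r - d) / (C + 1)"
      have \<delta>: "\<delta> > 0" and C\<delta>: "C * \<delta> + d < r"
        using dr C unfolding \<delta>_def by (auto simp: field_simps)
      let ?B = "{g \<in> V. p (\<lambda>x. g x - h x) < ennreal \<delta>}"
      have "h \<in> ?B"
        using h \<delta> P0[OF p] by simp
      moreover have "F g \<in> U" if "g \<in> ?B" for g
      proof -
        have g: "g \<in> V" and "p (\<lambda>x. g x - h x) \<le> ennreal \<delta>"
          using that by auto
        then have "ennreal C * p (\<lambda>x. g x - h x) \<le> ennreal C * ennreal \<delta>"
          by (intro mult_left_mono) auto
        then have "ennreal C * p (\<lambda>x. g x - h x) \<le> ennreal (C * \<delta>)"
          using C \<delta> by (simp add: ennreal_mult)
        then have "q (\<lambda>y. F g y - F h y) \<le> ennreal (C * \<delta>)"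
          using pC[OF V_diff[OF g h]] unfolding F_diff[OF g h] by (rule order_trans[rotated])
        moreover have "q (\<lambda>y. F g y - f0 y) \<le> q (\<lambda>y. F g y - F h y) + q (\<lambda>y. F h y - f0 y)"
          using maps g h f0 by (intro Q_triangle[OF q]) auto
        ultimately have "q (\<lambda>y. F g y - f0 y) \<le> ennreal (C * \<delta>) + ennreal d"
          unfolding d by (meson add_right_mono order_trans)
        also have "\<dots> < ennreal r"
          using C \<delta> d0 C\<delta> by (simp flip: ennreal_plus add: ennreal_less_iff)
        finally show ?thesis
          using maps g by (auto simp: U)
      qed
      moreover have "?B \<subseteq> topspace ?T"
        by (rule openin_subset[OF ball_open[OF p h \<delta>]])
      ultimately show "\<exists>T. openin ?T T \<and> h \<in> T \<and> T \<subseteq> F -` U \<inter> topspace ?T"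
        using ball_open[OF p h \<delta>] by (intro exI[of _ ?B]) blast
    qed
  next
    obtain q where q: "q \<in> Q"
      using \<open>Q \<noteq> {}\<close> by blast
    show "F ` topspace ?T \<subseteq> \<Union> {{g \<in> W. p (\<lambda>x. g x - f x) < ennreal r} |p f r. p \<in> Q \<and> f \<in> W \<and> 0 < r}"
    proof
      fix g assume "g \<in> F ` topspace ?T"
      then have g: "g \<in> W"
        using top_V maps by blast
      then have "g \<in> {g' \<in> W. q (\<lambda>x. g' x - g x) < ennreal 1}"
        using Q0[OF q] by simp
      with q g show "g \<in> \<Union> {{g \<in> W. p (\<lambda>x. g x - f x) < ennreal r} |p f r. p \<in> Q \<and> f \<in> W \<and> 0 < r}"
        using zero_less_one by blast
    qed
  qed
qed

section \<open>The two families of norms\<close>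

lemma S_norm_le_iff:
  assumes "C \<ge> 0"
  shows "S_norm \<phi> \<sigma> \<epsilon> k f \<le> ennreal C \<longleftrightarrow>
    (\<forall>z. norm (f z) * (1 + norm z) ^ k \<le> C * exp (\<phi> ((\<sigma> + \<epsilon>) * \<bar>Im z\<bar>)))"
  unfolding S_norm_def SUP_le_iff using assms
  by (simp add: divide_le_eq)

lemma G_norm_le_iff:
  assumes "C \<ge> 0" and "\<sigma> + \<epsilon> > 0"
  shows "G_norm w \<sigma> \<epsilon> m f \<le> ennreal C \<longleftrightarrow>
    (\<forall>n\<le>m. \<forall>x k. norm (complex_of_real x ^ k * nth_derivative n f x) \<le>
        C * (fact k * (\<sigma> + \<epsilon>) ^ k * exp (- w (real k))))"
proof -
  have pos: "0 < fact k * (\<sigma> + \<epsilon>) ^ k * exp (- w (real k))" for k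
    using assms(2) by simp
  have le: "ennreal (a / (fact k * (\<sigma> + \<epsilon>) ^ k * exp (- w (real k)))) \<le> ennreal C \<longleftrightarrow>
      a \<le> C * (fact k * (\<sigma> + \<epsilon>) ^ k * exp (- w (real k)))" for a k
    by (subst ennreal_le_iff[OF assms(1)]) (rule pos_divide_le_eq[OF pos])
  have "G_norm w \<sigma> \<epsilon> m f \<le> ennreal C \<longleftrightarrow> (\<forall>n\<in>{0..m}. \<forall>xk\<in>UNIV. 
      (case xk of (x, k) \<Rightarrow> ennreal (norm (complex_of_real x ^ k * nth_derivative n f x) /
                 (fact k * (\<sigma> + \<epsilon>) ^ k * exp (- w (real k))))) \<le> ennreal C)"
    unfolding G_norm_def by (subst Max_le_iff) (auto simp: SUP_le_iff)
  also have "\<dots> \<longleftrightarrow> (\<forall>n\<le>m. \<forall>x k. norm (complex_of_real x ^ k * nth_derivative n f x) \<le>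
        C * (fact k * (\<sigma> + \<epsilon>) ^ k * exp (- w (real k))))"
    by (auto simp: le)
  finally show ?thesis .
qed

lemma S_norm_triangle:
  "S_norm \<phi> \<sigma> \<epsilon> k (\<lambda>z. a z - c z) \<le>
     S_norm \<phi> \<sigma> \<epsilon> k (\<lambda>z. a z - b z) + S_norm \<phi> \<sigma> \<epsilon> k (\<lambda>z. b z - c z)"
  unfolding S_norm_def
proof (rule SUP_least)
  fix z :: complex
  let ?w = "\<lambda>v. norm v * (1 + norm z) ^ k / exp (\<phi> ((\<sigma> + \<epsilon>) * \<bar>Im z\<bar>))"
  have "norm (a z - c z) \<le> norm (a z - b z) + norm (b z - c z)"
    using norm_triangle_ineq[of "a z - b z" "b z - c z"] by simp
  then have "?w (a z - c z) \<le> (norm (a z - b z) + norm (b z - c z)) * (1 + norm z) ^ k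
      / exp (\<phi> ((\<sigma> + \<epsilon>) * \<bar>Im z\<bar>))"
    by (intro divide_right_mono mult_right_mono) auto
  then have "ennreal (?w (a z - c z)) \<le> ennreal (?w (a z - b z) + ?w (b z - c z))"
    by (intro ennreal_leI) (simp add: distrib_right add_divide_distrib)
  also have "\<dots> = ennreal (?w (a z - b z)) + ennreal (?w (b z - c z))"
    by (rule ennreal_plus) auto
  also have "\<dots> \<le> (SUP z. ennreal (norm (a z - b z) * (1 + norm z) ^ k / exp (\<phi> ((\<sigma> + \<epsilon>) * \<bar>Im z\<bar>))))
      + (SUP z. ennreal (norm (b z - c z) * (1 + norm z) ^ k / exp (\<phi> ((\<sigma> + \<epsilon>) * \<bar>Im z\<bar>))))"
    by (intro add_mono SUP_upper) auto
  finally show "ennreal (?w (a z - c z)) \<le> \<dots>" .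
qed

lemma nth_derivative_simps [simp]:
  "nth_derivative 0 f = f"
  "nth_derivative (Suc n) f = (\<lambda>x. vector_derivative (nth_derivative n f) (at x))"
  by (simp_all add: nth_derivative_def)

lemma C_class_has_derivative:
  assumes "\<And>m. f \<in> C_class m"
  shows "(nth_derivative n f has_vector_derivative nth_derivative (Suc n) f x) (at x)"
proof -
  have "nth_derivative n f differentiable_on UNIV"
    using assms[of "Suc n"] by (simp add: C_class_def)
  then show ?thesis
    by (simp add: differentiable_on_def vector_derivative_works)
qed

text \<open>
  Iterated derivatives are given by choice of a limit at each point, so they are best identified by
  exhibiting the whole sequence of derivatives at once; smoothness then comes for free.
\<close>

lemma derivative_sequence:
  assumes "\<And>n x. (F n has_vector_derivative F (Suc n) x) (at x)"
  shows "nth_derivative n (F 0) = F n" and "F 0 \<in> C_class m"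
proof -
  show *: "nth_derivative n (F 0) = F n" for n
    by (induction n) (auto intro!: vector_derivative_at assms)
  have "F n differentiable_on UNIV" for n
    using assms[of n] by (auto simp: differentiable_on_def has_vector_derivative_def differentiable_def)
  then show "F 0 \<in> C_class m"
    by (auto simp: C_class_def * intro: differentiable_imp_continuous_on)
qed

lemma nth_derivative_diff:
  assumes "\<And>m. f \<in> C_class m" and "\<And>m. g \<in> C_class m"
  shows "nth_derivative n (\<lambda>x. f x - g x) = (\<lambda>x. nth_derivative n f x - nth_derivative n g x)"
proof -
  have "((\<lambda>x. nth_derivative n f x - nth_derivative n g x) has_vector_derivative
      nth_derivative (Suc n) f x - nth_derivative (Suc n) g x) (at x)" for n x
    by (intro has_vector_derivative_diff C_class_has_derivative assms)
  from derivative_sequence(1)[of "\<lambda>n x. nth_derivative n f x - nth_derivative n g x", OF this]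
  show ?thesis
    by simp
qed

lemma C_class_diff:
  assumes "\<And>m. f \<in> C_class m" and "\<And>m. g \<in> C_class m"
  shows "(\<lambda>x. f x - g x) \<in> C_class m"
proof -
  have "((\<lambda>x. nth_derivative n f x - nth_derivative n g x) has_vector_derivative
      nth_derivative (Suc n) f x - nth_derivative (Suc n) g x) (at x)" for n x
    by (intro has_vector_derivative_diff C_class_has_derivative assms)
  from derivative_sequence(2)[of "\<lambda>n x. nth_derivative n f x - nth_derivative n g x", OF this]
  show ?thesis
    by simp
qed

text \<open>
  Smoothness is required because \<^const>\<open>nth_derivative\<close> need not be additive on functions that fail to be
  differentiable.
\<close>

lemma G_norm_triangle:
  assumes a: "\<And>m. a \<in> C_class m" and b: "\<And>m. b \<in> C_class m" and c: "\<And>m. c \<in> C_class m"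
    and pos: "\<sigma> + \<epsilon> > 0"
  shows "G_norm w \<sigma> \<epsilon> m (\<lambda>x. a x - c x) \<le>
     G_norm w \<sigma> \<epsilon> m (\<lambda>x. a x - b x) + G_norm w \<sigma> \<epsilon> m (\<lambda>x. b x - c x)"
proof (cases "G_norm w \<sigma> \<epsilon> m (\<lambda>x. a x - b x)"; cases "G_norm w \<sigma> \<epsilon> m (\<lambda>x. b x - c x)")
  fix r s assume rs: "0 \<le> r" "0 \<le> s"
    and r: "G_norm w \<sigma> \<epsilon> m (\<lambda>x. a x - b x) = ennreal r"
    and s: "G_norm w \<sigma> \<epsilon> m (\<lambda>x. b x - c x) = ennreal s"
  have "G_norm w \<sigma> \<epsilon> m (\<lambda>x. a x - c x) \<le> ennreal (r + s)"
  proof (subst G_norm_le_iff, safe)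
    fix n x k assume n: "n \<le> m"
    define M where "M = fact k * (\<sigma> + \<epsilon>) ^ k * exp (- w (real k))"
    let ?d = "\<lambda>f g. complex_of_real x ^ k * (nth_derivative n f x - nth_derivative n g x)"
    have "norm (?d a b) \<le> r * M" "norm (?d b c) \<le> s * M"
      using G_norm_le_iff[OF rs(1) pos, THEN iffD1, OF eq_refl[OF r]]
        G_norm_le_iff[OF rs(2) pos, THEN iffD1, OF eq_refl[OF s]] n
      by (simp_all only: nth_derivative_diff a b c M_def)
    moreover have "norm (?d a c) \<le> norm (?d a b) + norm (?d b c)"
      using norm_triangle_ineq[of "?d a b" "?d b c"] by (simp add: algebra_simps)
    ultimately show "norm (complex_of_real x ^ k * nth_derivative n (\<lambda>x. a x - c x) x) \<le> (r + s) * M"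
      by (simp add: nth_derivative_diff a c distrib_right)
  qed (use rs pos in auto)
  then show ?thesis
    using rs by (simp add: r s)
qed auto

section \<open>Elementary estimates for the exponential series\<close>

lemma power_le_fact_exp:
  fixes a :: real
  assumes "a \<ge> 0"
  shows "a ^ k \<le> fact k * exp a"
proof -
  have "(\<lambda>n. a ^ n /\<^sub>R fact n) sums exp a"
    by (rule exp_converges)
  then have "(\<Sum>n\<in>{k}. a ^ n /\<^sub>R fact n) \<le> exp a"
    using assms sum_le_suminf[of "\<lambda>n. a ^ n /\<^sub>R fact n" "{k}"] by (simp add: sums_iff)
  then show ?thesis
    by (simp add: field_simps)
qed

text \<open>
  The coefficients \<open>(k + 1) (k + 2)\<close> are those of the twice differentiated geometric series.
\<close>

lemma summable_quadratic_times_geometric: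
  fixes c q :: real
  assumes "0 \<le> q" "q < 1"
  shows "summable (\<lambda>k. (1 + (real k + 1) * (real k + 2) * c) * q ^ k)"
proof -
  have geo: "summable (\<lambda>n. 1 * x ^ n)" if "norm x < 1" for x :: real
    using summable_geometric[OF that] by simp
  have d1: "summable (\<lambda>n. diffs (\<lambda>_. 1) n * x ^ n)" if "norm x < 1" for x :: real
    using termdiff_converges[OF that geo] .
  have d2: "summable (\<lambda>n. diffs (diffs (\<lambda>_. 1)) n * q ^ n)"
    using termdiff_converges[OF _ d1, of q] assms by simp
  have "summable (\<lambda>n. c * (diffs (diffs (\<lambda>_. 1)) n * q ^ n) + q ^ n)"
    using assms by (intro summable_add summable_mult d2 summable_geometric) auto
  then show ?thesis
    by (rule back_subst) (simp add: fun_eq_iff diffs_def algebra_simps)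
qed

lemma one_plus_power_le:
  fixes a :: real
  assumes "a \<ge> 0"
  shows "(1 + a) ^ k \<le> 2 ^ k * (1 + a ^ k)"
proof -
  have "(1 + a) ^ k \<le> (2 * max 1 a) ^ k"
    using assms by (intro power_mono) auto
  also have "\<dots> = 2 ^ k * max 1 a ^ k"
    by (simp add: power_mult_distrib)
  also have "max 1 a ^ k \<le> 1 + a ^ k"
    using assms by (simp add: max_def)
  finally show ?thesis
    by simp
qed

section \<open>The weight and its Young conjugate\<close>

locale superlinear_weight =
  fixes \<phi> :: "real \<Rightarrow> real" and \<sigma> :: real
  assumes \<sigma>_pos: "\<sigma> > 0"
    and \<phi>_nonneg: "x \<ge> 0 \<Longrightarrow> \<phi> x \<ge> 0"
    and \<phi>_mono: "0 \<le> x \<Longrightarrow> x \<le> y \<Longrightarrow> \<phi> x \<le> \<phi> y"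
    and \<phi>_superlinear: "filterlim (\<lambda>x. \<phi> x / x) at_top at_top"
begin

abbreviation "\<psi>s \<equiv> young_conjugate (psi \<phi>)"

text \<open>
  Superlinearity of \<open>\<phi>\<close> makes \<open>\<phi> (exp y)\<close> dominate \<open>k * exp y\<close>, hence \<open>k * y\<close>, for large \<open>y\<close>; on the remaining
  bounded range nonnegativity of \<open>\<phi>\<close> suffices. The real supremum in the Young conjugate is thus a
  genuine one.
\<close>

lemma bdd_above_young: "bdd_above ((\<lambda>y. real k * y - psi \<phi> y) ` {0<..})"
proof -
  obtain U where U: "\<And>u. u \<ge> U \<Longrightarrow> real k \<le> \<phi> u / u"
    using \<phi>_superlinear unfolding filterlim_at_top eventually_at_top_linorder by meson
  have "real k * y - psi \<phi> y \<le> real k * \<bar>U\<bar>" if "y > 0" for y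
  proof (cases "exp y \<ge> U")
    case True
    have "y \<le> exp y"
      using exp_ge_add_one_self[of y] by linarith
    then have "real k * y \<le> real k * exp y"
      by (intro mult_left_mono) auto
    also have "\<dots> \<le> \<phi> (exp y)"
      using U[OF True] by (simp add: field_simps)
    finally show ?thesis
      by (simp add: psi_def) (smt (verit) of_nat_0_le_iff mult_nonneg_nonneg)
  next
    case False
    then have "y \<le> \<bar>U\<bar>"
      using exp_ge_add_one_self[of y] by linarith
    then have "real k * y \<le> real k * \<bar>U\<bar>"
      by (intro mult_left_mono) auto
    then show ?thesis
      using \<phi>_nonneg[of "exp y"] by (simp add: psi_def)
  qed
  then show ?thesis
    by (intro bdd_aboveI2) auto
qed

lemma young_ge: "y > 0 \<Longrightarrow> real k * y - \<phi> (exp y) \<le> \<psi>s (real k)"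
  unfolding young_conjugate_def
  by (rule cSUP_upper2[OF bdd_above_young, of y]) (auto simp: psi_def)

lemma young_mono:
  assumes "j \<le> k"
  shows "\<psi>s (real j) \<le> \<psi>s (real k)"
  unfolding young_conjugate_def
proof (rule cSUP_mono[OF _ bdd_above_young])
  fix y :: real assume "y \<in> {0<..}"
  then show "\<exists>y'\<in>{0<..}. real j * y - psi \<phi> y \<le> real k * y' - psi \<phi> y'"
    using assms by (intro bexI[of _ y]) (auto intro!: mult_right_mono)
qed simp

text \<open>
  The easy half of the duality, \<open>\<psi>(y) \<ge> k y - \<psi>*(k)\<close> at \<open>e\<^sup>y = h s\<close>, spends the dilation \<open>h\<close> on a geometric
  factor. The conjugate only sees \<open>y > 0\<close>, that is \<open>h s > 1\<close>; for smaller \<open>h s\<close> the inequality is used at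
  the point \<open>2\<close> instead, which costs the constant \<open>exp (\<phi> 2)\<close>.
\<close>

lemma exp_neg_young_le:
  assumes "s \<ge> 0" and "h > 1"
  shows "s ^ k * exp (- \<psi>s (real k)) \<le> (1 / h) ^ k * (exp (\<phi> 2) * exp (\<phi> (h * s)))"
proof -
  have pow: "u ^ k * exp (- \<psi>s (real k)) \<le> exp (\<phi> u)" if "u > 1" for u
  proof -
    have "real k * ln u - \<phi> u \<le> \<psi>s (real k)"
      using young_ge[of "ln u" k] that by simp
    then have "exp (real k * ln u - \<psi>s (real k)) \<le> exp (\<phi> u)"
      by simp
    then show ?thesis
      using that by (simp add: exp_diff exp_minus exp_of_nat_mult divide_inverse)
  qed
  have hs: "h * s \<ge> 0"
    using assms by simp
  have "(h * s) ^ k * exp (- \<psi>s (real k)) \<le> exp (\<phi> 2) * exp (\<phi> (h * s))"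
  proof (cases "h * s > 1")
    case True
    have "1 * exp (\<phi> (h * s)) \<le> exp (\<phi> 2) * exp (\<phi> (h * s))"
      using \<phi>_nonneg[of 2] by (intro mult_right_mono) auto
    with pow[OF True] show ?thesis
      by linarith
  next
    case False
    have "(h * s) ^ k * exp (- \<psi>s (real k)) \<le> 2 ^ k * exp (- \<psi>s (real k))"
      using False hs by (intro mult_right_mono power_mono) auto
    also have "\<dots> \<le> exp (\<phi> 2)"
      by (rule pow) simp
    also have "\<dots> \<le> exp (\<phi> 2) * exp (\<phi> (h * s))"
      using \<phi>_nonneg[OF hs] by simp
    finally show ?thesis .
  qed
  then show ?thesis
    using assms by (simp add: power_mult_distrib power_one_over divide_simps mult_ac)
qed

abbreviation "S \<equiv> S_space \<phi> \<sigma>"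
abbreviation "G \<equiv> G_space \<psi>s \<sigma>"

section \<open>Elements of the two spaces\<close>

lemma S_spaceD:
  assumes "f \<in> S"
  shows "f holomorphic_on UNIV"
    and "\<epsilon> > 0 \<Longrightarrow> \<exists>N\<ge>0. S_norm \<phi> \<sigma> \<epsilon> k f = ennreal N \<and>
      (\<forall>z. norm (f z) * (1 + norm z) ^ k \<le> N * exp (\<phi> ((\<sigma> + \<epsilon>) * \<bar>Im z\<bar>)))"
proof -
  have mem: "f \<in> S_eps \<phi> \<sigma> \<epsilon> k" if "\<epsilon> > 0" for \<epsilon> k
    using assms that by (auto simp: S_space_def)
  show "f holomorphic_on UNIV"
    using mem[of 1 0] by (simp add: S_eps_def)
  assume "\<epsilon> > 0"
  then have "S_norm \<phi> \<sigma> \<epsilon> k f < \<infinity>"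
    using mem by (auto simp: S_eps_def)
  then obtain N where N: "N \<ge> 0" "S_norm \<phi> \<sigma> \<epsilon> k f = ennreal N"
    by (cases "S_norm \<phi> \<sigma> \<epsilon> k f") auto
  with S_norm_le_iff[OF N(1), THEN iffD1, OF eq_refl[OF N(2)]]
  show "\<exists>N\<ge>0. S_norm \<phi> \<sigma> \<epsilon> k f = ennreal N \<and>
      (\<forall>z. norm (f z) * (1 + norm z) ^ k \<le> N * exp (\<phi> ((\<sigma> + \<epsilon>) * \<bar>Im z\<bar>)))"
    by blast
qed

lemma S_spaceI:
  assumes "f holomorphic_on UNIV"
    and "\<And>\<epsilon> k. \<epsilon> > 0 \<Longrightarrow> S_norm \<phi> \<sigma> \<epsilon> k f < \<infinity>"
  shows "f \<in> S"
  using assms by (auto simp: S_space_def S_eps_def)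

lemma G_spaceD:
  assumes "g \<in> G"
  shows "g \<in> C_class m"
    and "\<epsilon> > 0 \<Longrightarrow> \<exists>N\<ge>0. G_norm \<psi>s \<sigma> \<epsilon> m g = ennreal N \<and>
      (\<forall>n\<le>m. \<forall>x k. norm (complex_of_real x ^ k * nth_derivative n g x) \<le>
        N * (fact k * (\<sigma> + \<epsilon>) ^ k * exp (- \<psi>s (real k))))"
proof -
  have mem: "g \<in> G_eps \<psi>s \<sigma> \<epsilon> m" if "\<epsilon> > 0" for \<epsilon> m
    using assms that by (auto simp: G_space_def)
  show "g \<in> C_class m"
    using mem[of 1 m] by (simp add: G_eps_def)
  assume "\<epsilon> > 0"
  then have pos: "\<sigma> + \<epsilon> > 0" and "G_norm \<psi>s \<sigma> \<epsilon> m g < \<infinity>"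
    using mem \<sigma>_pos by (auto simp: G_eps_def)
  then obtain N where N: "N \<ge> 0" "G_norm \<psi>s \<sigma> \<epsilon> m g = ennreal N"
    by (cases "G_norm \<psi>s \<sigma> \<epsilon> m g") auto
  with G_norm_le_iff[OF N(1) pos, THEN iffD1, OF eq_refl[OF N(2)]]
  show "\<exists>N\<ge>0. G_norm \<psi>s \<sigma> \<epsilon> m g = ennreal N \<and>
      (\<forall>n\<le>m. \<forall>x k. norm (complex_of_real x ^ k * nth_derivative n g x) \<le>
        N * (fact k * (\<sigma> + \<epsilon>) ^ k * exp (- \<psi>s (real k))))"
    by blast
qed

lemma G_spaceI:
  assumes "\<And>m. g \<in> C_class m"
    and "\<And>\<epsilon> m. \<epsilon> > 0 \<Longrightarrow> G_norm \<psi>s \<sigma> \<epsilon> m g < \<infinity>"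
  shows "g \<in> G"
  using assms by (auto simp: G_space_def G_eps_def)

lemma S_diff:
  assumes "f \<in> S" "g \<in> S"
  shows "(\<lambda>z. f z - g z) \<in> S"
proof (rule S_spaceI)
  show "(\<lambda>z. f z - g z) holomorphic_on UNIV"
    by (intro holomorphic_on_diff S_spaceD(1) assms)
  fix \<epsilon> :: real and k assume \<epsilon>: "\<epsilon> > 0"
  obtain M N where MN: "M \<ge> 0" "N \<ge> 0"
    and M: "\<And>z. norm (f z) * (1 + norm z) ^ k \<le> M * exp (\<phi> ((\<sigma> + \<epsilon>) * \<bar>Im z\<bar>))"
    and N: "\<And>z. norm (g z) * (1 + norm z) ^ k \<le> N * exp (\<phi> ((\<sigma> + \<epsilon>) * \<bar>Im z\<bar>))"
    using S_spaceD(2)[OF assms(1) \<epsilon>] S_spaceD(2)[OF assms(2) \<epsilon>] by meson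
  have "S_norm \<phi> \<sigma> \<epsilon> k (\<lambda>z. f z - g z) \<le> ennreal (M + N)"
  proof (subst S_norm_le_iff, safe)
    fix z
    have "norm (f z - g z) * (1 + norm z) ^ k \<le> (norm (f z) + norm (g z)) * (1 + norm z) ^ k"
      by (intro mult_right_mono norm_triangle_ineq4) auto
    then show "norm (f z - g z) * (1 + norm z) ^ k \<le> (M + N) * exp (\<phi> ((\<sigma> + \<epsilon>) * \<bar>Im z\<bar>))"
      using M[of z] N[of z] by (simp add: distrib_right)
  qed (use MN in auto)
  then show "S_norm \<phi> \<sigma> \<epsilon> k (\<lambda>z. f z - g z) < \<infinity>"
    by (rule order.strict_trans1) simp
qed

lemma G_diff:
  assumes "f \<in> G" "g \<in> G"
  shows "(\<lambda>x. f x - g x) \<in> G"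
proof (rule G_spaceI)
  note C = G_spaceD(1)[OF assms(1)] G_spaceD(1)[OF assms(2)]
  show "(\<lambda>x. f x - g x) \<in> C_class m" for m
    by (intro C_class_diff C)
  fix \<epsilon> :: real and m assume \<epsilon>: "\<epsilon> > 0"
  then have pos: "\<sigma> + \<epsilon> > 0"
    using \<sigma>_pos by simp
  obtain M N where MN: "M \<ge> 0" "N \<ge> 0"
    and M: "\<And>n x k. n \<le> m \<Longrightarrow> norm (complex_of_real x ^ k * nth_derivative n f x) \<le>
        M * (fact k * (\<sigma> + \<epsilon>) ^ k * exp (- \<psi>s (real k)))"
    and N: "\<And>n x k. n \<le> m \<Longrightarrow> norm (complex_of_real x ^ k * nth_derivative n g x) \<le>
        N * (fact k * (\<sigma> + \<epsilon>) ^ k * exp (- \<psi>s (real k)))"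
    using G_spaceD(2)[OF assms(1) \<epsilon>] G_spaceD(2)[OF assms(2) \<epsilon>] by meson
  have "G_norm \<psi>s \<sigma> \<epsilon> m (\<lambda>x. f x - g x) \<le> ennreal (M + N)"
  proof (subst G_norm_le_iff, safe)
    fix n x k assume "n \<le> m"
    from M[OF this] N[OF this]
    show "norm (complex_of_real x ^ k * nth_derivative n (\<lambda>x. f x - g x) x) \<le>
        (M + N) * (fact k * (\<sigma> + \<epsilon>) ^ k * exp (- \<psi>s (real k)))"
      unfolding nth_derivative_diff[OF C] right_diff_distrib distrib_right
      by (intro order_trans[OF norm_triangle_ineq4] add_mono)
  qed (use MN pos in auto)
  then show "G_norm \<psi>s \<sigma> \<epsilon> m (\<lambda>x. f x - g x) < \<infinity>"
    by (rule order.strict_trans1) simp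
qed

section \<open>The Fourier transform maps into the space of smooth functions\<close>

text \<open>
  The line of integration is moved to height \<open>t\<close> on the side where the kernel decays, for every \<open>t > 0\<close>,
  and the resulting bounds are optimised over \<open>t\<close>. The exponent \<open>m + 2\<close> leaves, after the factor
  \<open>\<xi>\<^sup>n\<close> with \<open>n \<le> m\<close>, the quadratic decay needed for integrating.
\<close>

lemma fourier_moment_estimate:
  assumes hol: "f holomorphic_on UNIV"
    and \<epsilon>: "\<epsilon> > 0" and N: "N \<ge> 0"
    and f: "\<And>z. norm (f z) * (1 + norm z) ^ (m + 2) \<le> N * exp (\<phi> ((\<sigma> + \<epsilon>) * \<bar>Im z\<bar>))"
    and n: "n \<le> m"
  shows "norm (of_real x ^ k * (LINT \<xi>|lborel. ((- \<i> * of_real \<xi>) ^ n * f (of_real \<xi>)) * iexp (- (x * \<xi>))))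
      \<le> pi * N * (fact k * (\<sigma> + \<epsilon>) ^ k * exp (- \<psi>s (real k)))"
proof -
  define s where "s = \<sigma> + \<epsilon>"
  have s: "s > 0"
    using \<epsilon> \<sigma>_pos by (simp add: s_def)
  define h where "h z = ((- \<i> * z) ^ n * f z) * exp (- (\<i> * of_real x * z))" for z
  define J where "J = (LINT \<xi>|lborel. h (of_real \<xi>))"
  have holh: "h holomorphic_on UNIV"
    unfolding h_def by (intro holomorphic_intros hol)
  have h_decay: "norm (h z) * (1 + (Re z)\<^sup>2) \<le> N * exp (\<phi> (s * \<bar>Im z\<bar>)) * exp (x * Im z)" for z
  proof -
    have "1 + (Re z)\<^sup>2 \<le> (1 + norm z)\<^sup>2"
      using abs_Re_le_cmod[of z] power_mono[of "\<bar>Re z\<bar>" "norm z" 2]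
      by (simp add: power2_sum)
    moreover have "norm z ^ n \<le> (1 + norm z) ^ m"
      using n by (intro order_trans[OF power_mono[of "norm z" "1 + norm z" n] power_increasing]) auto
    ultimately have "norm z ^ n * (1 + (Re z)\<^sup>2) \<le> (1 + norm z) ^ m * (1 + norm z)\<^sup>2"
      by (intro mult_mono) auto
    then have "norm (f z) * (norm z ^ n * (1 + (Re z)\<^sup>2)) \<le> norm (f z) * (1 + norm z) ^ (m + 2)"
      unfolding power_add by (intro mult_left_mono) auto
    also have "\<dots> \<le> N * exp (\<phi> (s * \<bar>Im z\<bar>))"
      using f[of z] by (simp add: s_def)
    finally have "norm (f z) * (norm z ^ n * (1 + (Re z)\<^sup>2)) * exp (x * Im z)
        \<le> N * exp (\<phi> (s * \<bar>Im z\<bar>)) * exp (x * Im z)"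
      by (intro mult_right_mono) auto
    then show ?thesis
      by (simp add: h_def norm_mult norm_power mult_ac)
  qed
  have J_le: "norm J \<le> pi * (N * exp (\<phi> (s * t) - \<bar>x\<bar> * t))" if t: "t > 0" for t
  proof -
    \<comment> \<open>The height is signed so that the kernel has norm \<^term>\<open>exp (- (\<bar>x\<bar> * t))\<close> on the new line.\<close>
    define \<eta> where "\<eta> = (if x \<ge> 0 then - t else t)"
    have \<eta>: "\<bar>\<eta>\<bar> = t" "x * \<eta> = - (\<bar>x\<bar> * t)"
      using t by (auto simp: \<eta>_def)
    have "(LINT \<xi>|lborel. h (Complex \<xi> \<eta>)) = J"
      unfolding J_def
    proof (rule integral_horizontal_line_shift[OF holh])
      fix z assume z: "\<bar>Im z\<bar> \<le> \<bar>\<eta>\<bar>"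
      have "\<phi> (s * \<bar>Im z\<bar>) \<le> \<phi> (s * t)"
        using z s \<eta> by (intro \<phi>_mono mult_left_mono) auto
      moreover have "x * Im z \<le> \<bar>x\<bar> * t"
      proof -
        have "x * Im z \<le> \<bar>x\<bar> * \<bar>Im z\<bar>"
          by (simp flip: abs_mult)
        also have "\<dots> \<le> \<bar>x\<bar> * t"
          using z \<eta> by (intro mult_left_mono) auto
        finally show ?thesis .
      qed
      ultimately have "N * exp (\<phi> (s * \<bar>Im z\<bar>)) * exp (x * Im z) \<le> N * exp (\<phi> (s * t)) * exp (\<bar>x\<bar> * t)"
        using N by (intro mult_mono) auto
      with h_decay[of z] show "norm (h z) * (1 + (Re z)\<^sup>2) \<le> N * exp (\<phi> (s * t)) * exp (\<bar>x\<bar> * t)"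
        by linarith
    qed
    moreover have "norm (LINT \<xi>|lborel. h (Complex \<xi> \<eta>)) \<le> pi * (N * exp (\<phi> (s * t) - \<bar>x\<bar> * t))"
    proof (rule quadratic_decay_integral(2))
      have "continuous_on UNIV (\<lambda>\<xi>. h (of_real \<xi> + \<i> * of_real \<eta>))"
        by (intro continuous_on_compose2[OF holomorphic_on_imp_continuous_on[OF holh]]
            continuous_intros) auto
      moreover have "of_real \<xi> + \<i> * of_real \<eta> = Complex \<xi> \<eta>" for \<xi>
        by (simp add: complex_eq_iff)
      ultimately show "continuous_on UNIV (\<lambda>\<xi>. h (Complex \<xi> \<eta>))"
        by simp
      show "norm (h (Complex \<xi> \<eta>)) * (1 + \<xi>\<^sup>2) \<le> N * exp (\<phi> (s * t) - \<bar>x\<bar> * t)" for \<xi>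
        using h_decay[of "Complex \<xi> \<eta>"] by (simp add: \<eta> exp_diff exp_minus divide_inverse mult.assoc)
    qed
    ultimately show ?thesis
      by simp
  qed
  have step: "\<bar>x\<bar> ^ k * norm J \<le> pi * N * (fact k * s ^ k) * exp (- (real k * y - psi \<phi> y))"
    if y: "y > 0" for y
  proof -
    \<comment> \<open>The height at which the growth \<^term>\<open>\<phi> (s * t)\<close> becomes \<^term>\<open>psi \<phi> y\<close>.\<close>
    define t where "t = exp y / s"
    have t: "t > 0" and st: "s * t = exp y"
      using s by (simp_all add: t_def)
    have "(\<bar>x\<bar> * t) ^ k \<le> fact k * exp (\<bar>x\<bar> * t)"
      using t by (intro power_le_fact_exp) auto
    then have x_le: "\<bar>x\<bar> ^ k \<le> fact k * exp (\<bar>x\<bar> * t) / t ^ k"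
      using t by (simp add: power_mult_distrib field_simps)
    have "\<bar>x\<bar> ^ k * norm J \<le> (fact k * exp (\<bar>x\<bar> * t) / t ^ k) * (pi * (N * exp (\<phi> (s * t) - \<bar>x\<bar> * t)))"
      using t by (intro mult_mono x_le J_le) auto
    also have "\<dots> = pi * N * (fact k / t ^ k) * (exp (\<bar>x\<bar> * t) * exp (\<phi> (s * t) - \<bar>x\<bar> * t))"
      by simp
    also have "exp (\<bar>x\<bar> * t) * exp (\<phi> (s * t) - \<bar>x\<bar> * t) = exp (psi \<phi> y)"
      by (simp add: psi_def st flip: exp_add)
    also have "fact k / t ^ k = fact k * s ^ k * exp (- (real k * y))"
      using s by (simp add: t_def power_divide exp_minus exp_of_nat_mult exp_of_nat2_mult field_simps)
    also have "pi * N * (fact k * s ^ k * exp (- (real k * y))) * exp (psi \<phi> y) =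
        pi * N * (fact k * s ^ k) * exp (- (real k * y - psi \<phi> y))"
      by (simp add: exp_diff exp_minus field_simps)
    finally show ?thesis .
  qed
  \<comment> \<open>The conjugate is a supremum over \<^term>\<open>y\<close>; bounding it from above requires taking logarithms,
      hence a nonzero left-hand side.\<close>
  have "\<bar>x\<bar> ^ k * norm J \<le> pi * N * (fact k * s ^ k) * exp (- \<psi>s (real k))"
  proof (cases "\<bar>x\<bar> ^ k * norm J = 0")
    case True
    show ?thesis
      unfolding True using N s by simp
  next
    case False
    define a where "a = \<bar>x\<bar> ^ k * norm J"
    define b where "b = pi * N * (fact k * s ^ k)"
    have a: "a > 0"
      using False unfolding a_def by (simp add: zero_less_mult_iff)
    have swap: "a \<le> b * exp (- v) \<longleftrightarrow> exp v \<le> b / a" for v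
      using a by (simp add: exp_minus field_simps)
    have ab: "a \<le> b * exp (- (real k * y - psi \<phi> y))" if "y > 0" for y
      using step[OF that] by (simp add: a_def b_def)
    have b: "b > 0"
      using a ab[of 1] by (smt (verit) exp_gt_zero mult_le_0_iff)
    have "real k * y - psi \<phi> y \<le> ln (b / a)" if "y > 0" for y
    proof -
      have "exp (real k * y - psi \<phi> y) \<le> b / a"
        using ab[OF that] by (rule swap[THEN iffD1])
      then show ?thesis
        using a b by (subst ln_ge_iff) auto
    qed
    then have "\<psi>s (real k) \<le> ln (b / a)"
      unfolding young_conjugate_def by (intro cSUP_least) auto
    then have "exp (\<psi>s (real k)) \<le> b / a"
      using a b by (subst (asm) ln_ge_iff) auto
    then have "a \<le> b * exp (- \<psi>s (real k))"
      by (rule swap[THEN iffD2])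
    then show ?thesis
      by (simp add: a_def b_def)
  qed
  moreover have "(LINT \<xi>|lborel. ((- \<i> * of_real \<xi>) ^ n * f (of_real \<xi>)) * iexp (- (x * \<xi>))) = J"
    unfolding J_def h_def by (simp add: mult.assoc)
  ultimately show ?thesis
    by (simp add: norm_mult norm_power s_def mult.assoc)
qed

lemma continuous_on_S_real:
  assumes "f \<in> S"
  shows "continuous_on UNIV (\<lambda>\<xi>. f (of_real \<xi>))"
  by (rule continuous_on_compose2[OF holomorphic_on_imp_continuous_on[OF S_spaceD(1)[OF assms]]])
     (auto intro: continuous_intros)

lemma integrable_S_real:
  assumes "f \<in> S"
  shows "integrable lborel (\<lambda>\<xi>. of_real \<xi> ^ j * f (of_real \<xi>))"
proof -
  obtain N where N: "\<And>z. norm (f z) * (1 + norm z) ^ (j + 2) \<le> N * exp (\<phi> ((\<sigma> + 1) * \<bar>Im z\<bar>))"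
    using S_spaceD(2)[OF assms zero_less_one] by meson
  show ?thesis
  proof (rule quadratic_decay_integral(1))
    show "continuous_on UNIV (\<lambda>\<xi>. of_real \<xi> ^ j * f (of_real \<xi>))"
      by (intro continuous_intros continuous_on_S_real assms)
    fix \<xi> :: real
    have "\<bar>\<xi>\<bar> ^ j * (1 + \<xi>\<^sup>2) \<le> (1 + \<bar>\<xi>\<bar>) ^ j * (1 + \<bar>\<xi>\<bar>)\<^sup>2"
      by (intro mult_mono power_mono) (auto simp: power2_sum)
    then have "norm (f (of_real \<xi>)) * (\<bar>\<xi>\<bar> ^ j * (1 + \<xi>\<^sup>2)) \<le> norm (f (of_real \<xi>)) * (1 + \<bar>\<xi>\<bar>) ^ (j + 2)"
      unfolding power_add by (intro mult_left_mono) auto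
    also have "\<dots> \<le> N * exp (\<phi> 0)"
      using N[of "of_real \<xi>"] by simp
    finally show "norm (of_real \<xi> ^ j * f (of_real \<xi>)) * (1 + \<xi>\<^sup>2) \<le> N * exp (\<phi> 0)"
      by (simp add: norm_mult norm_power mult_ac)
  qed
qed

lemma fourier_eq: "fourier f x = (LINT \<xi>|lborel. f (of_real \<xi>) * iexp (- (x * \<xi>)))"
  by (simp add: fourier_def)

lemma integrable_fourier_integrand:
  assumes "f \<in> S"
  shows "integrable lborel (\<lambda>\<xi>. f (of_real \<xi>) * exp (- \<i> * complex_of_real (x * \<xi>)))"
proof -
  have f: "integrable lborel (\<lambda>\<xi>. f (of_real \<xi>))"
    using integrable_S_real[OF assms, of 0] by simp
  show ?thesis
    by (rule Bochner_Integration.integrable_bound[OF f]) (use f in \<open>auto simp: norm_mult\<close>)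
qed

lemma fourier_derivatives:
  assumes f: "f \<in> S"
  shows "nth_derivative n (fourier f) =
      (\<lambda>x. LINT \<xi>|lborel. ((- \<i> * of_real \<xi>) ^ n * f (of_real \<xi>)) * iexp (- (x * \<xi>)))"
    and "fourier f \<in> C_class m"
proof -
  define F where "F n x = (LINT \<xi>|lborel. ((- \<i> * of_real \<xi>) ^ n * f (of_real \<xi>)) * iexp (- (x * \<xi>)))" for n x
  have F0: "F 0 = fourier f"
    by (simp add: F_def fourier_eq fun_eq_iff)
  have "(F n has_vector_derivative F (Suc n) x) (at x)" for n x
  proof -
    have int: "integrable lborel (\<lambda>\<xi>. of_real \<xi> ^ j * ((- \<i> * of_real \<xi>) ^ n * f (of_real \<xi>)))" for j
    proof -
      have "of_real \<xi> ^ j * ((- \<i> * of_real \<xi>) ^ n * f (of_real \<xi>)) =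
          (- \<i>) ^ n * (of_real \<xi> ^ (j + n) * f (of_real \<xi>))" for \<xi> :: real
        by (simp only: power_mult_distrib power_add mult_ac)
      then show ?thesis
        using integrable_S_real[OF f, of "j + n"] by (simp only: integrable_mult_right)
    qed
    have "((\<lambda>x. LINT \<xi>|lborel. ((- \<i> * of_real \<xi>) ^ n * f (of_real \<xi>)) * iexp (- (x * \<xi>)))
        has_vector_derivative
        (LINT \<xi>|lborel. (- \<i> * of_real \<xi>) * ((- \<i> * of_real \<xi>) ^ n * f (of_real \<xi>)) * iexp (- (x * \<xi>)))) (at x)"
      using int[of 0] int[of 1] int[of 2]
      by (intro has_vector_derivative_fourier_integral) simp_all
    then show ?thesis
      unfolding F_def by (simp only: power_Suc mult.assoc)
  qed
  from derivative_sequence[of F, OF this]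
  show "nth_derivative n (fourier f) =
      (\<lambda>x. LINT \<xi>|lborel. ((- \<i> * of_real \<xi>) ^ n * f (of_real \<xi>)) * iexp (- (x * \<xi>)))"
    and "fourier f \<in> C_class m"
    by (simp_all add: F0, simp add: F_def fun_eq_iff)
qed

lemma G_norm_fourier_le:
  assumes f: "f \<in> S" and \<epsilon>: "\<epsilon> > 0"
  shows "G_norm \<psi>s \<sigma> \<epsilon> m (fourier f) \<le> ennreal pi * S_norm \<phi> \<sigma> \<epsilon> (m + 2) f"
proof -
  obtain N where N: "N \<ge> 0" "S_norm \<phi> \<sigma> \<epsilon> (m + 2) f = ennreal N"
    and bnd: "\<And>z. norm (f z) * (1 + norm z) ^ (m + 2) \<le> N * exp (\<phi> ((\<sigma> + \<epsilon>) * \<bar>Im z\<bar>))"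
    using S_spaceD(2)[OF f \<epsilon>] by meson
  have "G_norm \<psi>s \<sigma> \<epsilon> m (fourier f) \<le> ennreal (pi * N)"
    using N \<epsilon> \<sigma>_pos
    by (subst G_norm_le_iff)
       (auto simp only: fourier_derivatives(1)[OF f] intro!: fourier_moment_estimate[OF S_spaceD(1)[OF f] \<epsilon> N(1) bnd] mult_nonneg_nonneg pi_ge_zero add_pos_pos)
  then show ?thesis
    using N by (simp add: ennreal_mult)
qed

lemma fourier_in_G:
  assumes "f \<in> S"
  shows "fourier f \<in> G"
proof (rule G_spaceI)
  show "fourier f \<in> C_class m" for m
    by (rule fourier_derivatives(2)[OF assms])
  fix \<epsilon> :: real and m assume \<epsilon>: "\<epsilon> > 0"
  obtain N where "S_norm \<phi> \<sigma> \<epsilon> (m + 2) f = ennreal N"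
    using S_spaceD(2)[OF assms \<epsilon>] by meson
  then show "G_norm \<psi>s \<sigma> \<epsilon> m (fourier f) < \<infinity>"
    using G_norm_fourier_le[OF assms \<epsilon>, of m]
    by (auto elim!: order.strict_trans1 simp: ennreal_mult_less_top)
qed

lemma fourier_diff:
  assumes "f \<in> S" "g \<in> S"
  shows "fourier (\<lambda>z. f z - g z) = (\<lambda>x. fourier f x - fourier g x)"
  unfolding fourier_def left_diff_distrib
  by (intro ext Bochner_Integration.integral_diff integrable_fourier_integrand assms)

lemma linear_fourier: "linear_on_set S fourier"
  unfolding linear_on_set_def
proof (intro conjI ballI allI)
  fix f g assume "f \<in> S" "g \<in> S"
  then show "fourier (\<lambda>x. f x + g x) = (\<lambda>x. fourier f x + fourier g x)"
    unfolding fourier_def distrib_right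
    by (intro ext Bochner_Integration.integral_add integrable_fourier_integrand)
next
  fix f :: "complex \<Rightarrow> complex" and c
  show "fourier (\<lambda>x. c * f x) = (\<lambda>x. c * fourier f x)"
    unfolding fourier_def mult.assoc by (intro ext integral_mult_right_zero)
qed

section \<open>Exponential decay of the smooth functions\<close>

text \<open>
  The \<open>k\<close>-th term of a convergent series dominating the expansion of \<open>(1 + x\<^sup>2) * exp (\<bar>x\<bar> * t)\<close> weighted by an
  element of \<open>G\<close>, apart from the growth factor \<open>exp (\<phi> (h * (s * t)))\<close> which is common to all \<open>k\<close>.
\<close>

definition majorant :: "real \<Rightarrow> real \<Rightarrow> nat \<Rightarrow> real" where
  "majorant s h k = exp (\<phi> 2) * ((1 + (real k + 1) * (real k + 2) * s\<^sup>2) * (1 / h) ^ k)"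

lemma summable_majorant: "h > 1 \<Longrightarrow> summable (majorant s h)"
  unfolding majorant_def by (intro summable_mult summable_quadratic_times_geometric) auto

lemma majorant_nonneg: "h > 1 \<Longrightarrow> 0 \<le> majorant s h k"
  unfolding majorant_def by (intro mult_nonneg_nonneg add_nonneg_nonneg) auto

text \<open>
  The factor \<open>1 + x\<^sup>2\<close> is paid for by using the hypothesis at \<open>k\<close> and at \<open>k + 2\<close>. Passing from \<open>(k + 2)!\<close> back to \<open>k!\<close>
  produces the quadratic factor of the majorant, and monotonicity of the Young conjugate lets the weight
  at \<open>k + 2\<close> be replaced by the one at \<open>k\<close>.
\<close>

lemma exp_series_term_le:
  assumes N: "N \<ge> 0" and s: "s > 0" and h: "h > 1" and t: "t \<ge> 0"
    and v: "\<And>k. \<bar>x\<bar> ^ k * v \<le> N * (fact k * s ^ k * exp (- \<psi>s (real k)))"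
  shows "v * (1 + x\<^sup>2) * ((\<bar>x\<bar> * t) ^ k / fact k) \<le> N * majorant s h k * exp (\<phi> (h * (s * t)))"
proof -
  define E where "E = (1 / h) ^ k * (exp (\<phi> 2) * exp (\<phi> (h * (s * t))))"
  define y where "y = exp (- \<psi>s (real k))"
  have y: "(s * t) ^ k * y \<le> E"
    unfolding E_def y_def using s t h by (intro exp_neg_young_le) auto
  have "\<bar>x\<bar> ^ k * v * (t ^ k / fact k) \<le> N * (fact k * s ^ k * y) * (t ^ k / fact k)"
    using v[of k] t unfolding y_def by (intro mult_right_mono) auto
  also have "\<dots> = N * ((s * t) ^ k * y)"
    by (simp add: power_mult_distrib)
  also have "\<dots> \<le> N * E"
    using y N by (intro mult_left_mono)
  finally have 1: "\<bar>x\<bar> ^ k * v * (t ^ k / fact k) \<le> N * E" .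
  have "\<bar>x\<bar> ^ (k + 2) * v * (t ^ k / fact k) \<le>
      N * (fact (k + 2) * s ^ (k + 2) * exp (- \<psi>s (real (k + 2)))) * (t ^ k / fact k)"
    using v[of "k + 2"] t by (intro mult_right_mono) auto
  also have "\<dots> \<le> N * (fact (k + 2) * s ^ (k + 2) * y) * (t ^ k / fact k)"
    unfolding y_def using N s t young_mono[of k "k + 2"] by (intro mult_right_mono mult_left_mono) auto
  also have "\<dots> = N * ((real k + 1) * (real k + 2) * s\<^sup>2) * ((s * t) ^ k * y)"
    by (simp add: power_mult_distrib power_add field_simps power2_eq_square)
  also have "\<dots> \<le> N * ((real k + 1) * (real k + 2) * s\<^sup>2) * E"
    using y N by (intro mult_left_mono) auto
  finally have 2: "\<bar>x\<bar> ^ (k + 2) * v * (t ^ k / fact k) \<le> N * ((real k + 1) * (real k + 2) * s\<^sup>2) * E" .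
  have "v * (1 + x\<^sup>2) * ((\<bar>x\<bar> * t) ^ k / fact k) =
      \<bar>x\<bar> ^ k * v * (t ^ k / fact k) + \<bar>x\<bar> ^ (k + 2) * v * (t ^ k / fact k)"
  proof -
    have *: "\<bar>x\<bar> ^ (k + 2) = \<bar>x\<bar> ^ k * x\<^sup>2"
      by (simp only: power_add power2_abs)
    show ?thesis
      unfolding * power_mult_distrib by (simp add: field_simps)
  qed
  also have "\<dots> \<le> N * E + N * ((real k + 1) * (real k + 2) * s\<^sup>2) * E"
    using 1 2 by (rule add_mono)
  also have "\<dots> = N * majorant s h k * exp (\<phi> (h * (s * t)))"
    unfolding majorant_def E_def by (simp only: distrib_left distrib_right mult_1_left mult_1_right mult_ac)
  finally show ?thesis .
qed

text \<open>
  Summing the previous estimate over \<open>k\<close> rebuilds the exponential series. This converts the factorial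
  decay of the elements of \<open>G\<close> into exponential decay at every rate \<open>t\<close>, with the growth in \<open>t\<close> that the
  norms of \<open>S\<close> allow.
\<close>

lemma exp_weighted_decay:
  assumes N: "N \<ge> 0" and s: "s > 0" and h: "h > 1" and t: "t \<ge> 0"
    and v: "\<And>k. \<bar>x\<bar> ^ k * v \<le> N * (fact k * s ^ k * exp (- \<psi>s (real k)))"
  shows "v * (1 + x\<^sup>2) * exp (\<bar>x\<bar> * t) \<le> N * suminf (majorant s h) * exp (\<phi> (h * (s * t)))"
proof (rule sums_le)
  show "v * (1 + x\<^sup>2) * ((\<bar>x\<bar> * t) ^ k / fact k) \<le> N * majorant s h k * exp (\<phi> (h * (s * t)))" for k
    by (rule exp_series_term_le[OF assms])
  have "(\<lambda>k. (\<bar>x\<bar> * t) ^ k / fact k) sums exp (\<bar>x\<bar> * t)"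
    using exp_converges[of "\<bar>x\<bar> * t"] by (simp add: divide_inverse mult.commute)
  then show "(\<lambda>k. v * (1 + x\<^sup>2) * ((\<bar>x\<bar> * t) ^ k / fact k)) sums (v * (1 + x\<^sup>2) * exp (\<bar>x\<bar> * t))"
    by (rule sums_mult)
  show "(\<lambda>k. N * majorant s h k * exp (\<phi> (h * (s * t)))) sums
      (N * suminf (majorant s h) * exp (\<phi> (h * (s * t))))"
    by (intro sums_mult2 sums_mult summable_sums summable_majorant h)
qed

text \<open>
  The value of \<open>h\<close> for which growth at \<open>h * ((\<sigma> + \<epsilon> / 2) * t)\<close> is growth at \<open>(\<sigma> + \<epsilon>) * t\<close>.
\<close>

definition dilation :: "real \<Rightarrow> real" where
  "dilation \<epsilon> = (\<sigma> + \<epsilon>) / (\<sigma> + \<epsilon> / 2)"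

lemma dilation_gt_1: "\<epsilon> > 0 \<Longrightarrow> dilation \<epsilon> > 1"
  using \<sigma>_pos by (simp add: dilation_def field_simps)

lemma dilation_mult: "\<epsilon> > 0 \<Longrightarrow> dilation \<epsilon> * ((\<sigma> + \<epsilon> / 2) * t) = (\<sigma> + \<epsilon>) * t"
  using \<sigma>_pos by (simp add: dilation_def)

text \<open>
  The constant lost in passing from the decay norms with \<open>\<epsilon> / 2\<close> to the growth norms with \<open>\<epsilon>\<close>.
\<close>

definition gain :: "real \<Rightarrow> real" where
  "gain \<epsilon> = suminf (majorant (\<sigma> + \<epsilon> / 2) (dilation \<epsilon>))"

lemma gain_nonneg: "\<epsilon> > 0 \<Longrightarrow> gain \<epsilon> \<ge> 0"
  unfolding gain_def by (intro suminf_nonneg summable_majorant majorant_nonneg dilation_gt_1)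

lemma G_estimate:
  assumes g: "g \<in> G" and \<epsilon>: "\<epsilon> > 0"
  shows "\<exists>N\<ge>0. G_norm \<psi>s \<sigma> (\<epsilon> / 2) m g = ennreal N \<and>
    (\<forall>n\<le>m. \<forall>x k. \<bar>x\<bar> ^ k * norm (nth_derivative n g x) \<le>
        N * (fact k * (\<sigma> + \<epsilon> / 2) ^ k * exp (- \<psi>s (real k))))"
  using G_spaceD(2)[OF g half_gt_zero[OF \<epsilon>], of m]
  by (simp only: norm_mult norm_power norm_of_real)

lemma continuous_on_G_derivative:
  assumes "g \<in> G"
  shows "continuous_on UNIV (nth_derivative n g)"
  using G_spaceD(1)[OF assms, of n] by (simp add: C_class_def)

section \<open>The inverse transform\<close>

definition inverse_fourier :: "(real \<Rightarrow> complex) \<Rightarrow> complex \<Rightarrow> complex" where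
  "inverse_fourier g z = (1 / (2 * pi)) * (LINT x|lborel. g x * exp (\<i> * of_real x * z))"

lemma norm_exp_kernel_le: "norm (exp (\<i> * of_real x * z)) \<le> exp (\<bar>x\<bar> * \<bar>Im z\<bar>)"
proof -
  have "- (x * Im z) \<le> \<bar>x\<bar> * \<bar>Im z\<bar>"
    using abs_ge_minus_self[of "x * Im z"] by (simp only: abs_mult)
  then show ?thesis
    by simp
qed

lemma kernel_integrand_decay:
  assumes N: "N \<ge> 0" and \<epsilon>: "\<epsilon> > 0"
    and v: "\<And>k. \<bar>x\<bar> ^ k * norm v \<le> N * (fact k * (\<sigma> + \<epsilon> / 2) ^ k * exp (- \<psi>s (real k)))"
  shows "norm (v * exp (\<i> * of_real x * z)) * (1 + x\<^sup>2) \<le>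
      N * gain \<epsilon> * exp (\<phi> ((\<sigma> + \<epsilon>) * \<bar>Im z\<bar>))"
proof -
  have s: "\<sigma> + \<epsilon> / 2 > 0"
    using \<sigma>_pos \<epsilon> by simp
  have "norm (v * exp (\<i> * of_real x * z)) * (1 + x\<^sup>2) =
      (norm v * (1 + x\<^sup>2)) * norm (exp (\<i> * of_real x * z))"
    by (simp only: norm_mult mult_ac)
  also have "\<dots> \<le> (norm v * (1 + x\<^sup>2)) * exp (\<bar>x\<bar> * \<bar>Im z\<bar>)"
    by (intro mult_left_mono norm_exp_kernel_le) auto
  also have "\<dots> \<le> N * gain \<epsilon> * exp (\<phi> (dilation \<epsilon> * ((\<sigma> + \<epsilon> / 2) * \<bar>Im z\<bar>)))"
    unfolding gain_def by (intro exp_weighted_decay N s dilation_gt_1[OF \<epsilon>] v) auto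
  finally show ?thesis
    by (simp only: dilation_mult[OF \<epsilon>])
qed

lemma continuous_kernel_integrand:
  assumes "g \<in> G"
  shows "continuous_on UNIV (\<lambda>x. nth_derivative n g x * exp (\<i> * of_real x * z))"
  by (intro continuous_intros continuous_on_G_derivative[OF assms])

lemma integrable_kernel:
  assumes g: "g \<in> G"
  shows "integrable lborel (\<lambda>x. nth_derivative n g x * exp (\<i> * of_real x * z))"
proof -
  obtain N where N: "N \<ge> 0" and v: "\<And>m x k. m \<le> n \<Longrightarrow> \<bar>x\<bar> ^ k * norm (nth_derivative m g x) \<le>
        N * (fact k * (\<sigma> + 1 / 2) ^ k * exp (- \<psi>s (real k)))"
    using G_estimate[OF g zero_less_one, of n] by meson
  show ?thesis
    by (rule quadratic_decay_integral(1)[OF continuous_kernel_integrand[OF g]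
          kernel_integrand_decay[OF N zero_less_one v[OF order_refl]]])
qed

lemma kernel_integral_by_parts:
  assumes g: "g \<in> G"
  shows "(\<i> * z) * (LINT x|lborel. nth_derivative n g x * exp (\<i> * of_real x * z)) =
      - (LINT x|lborel. nth_derivative (Suc n) g x * exp (\<i> * of_real x * z))"
proof -
  let ?e = "\<lambda>x. exp (\<i> * complex_of_real x * z)"
  let ?H = "\<lambda>x. nth_derivative n g x * ?e x"
  let ?H' = "\<lambda>x. nth_derivative (Suc n) g x * ?e x"
  obtain N where N: "N \<ge> 0" and v: "\<And>m x k. m \<le> Suc n \<Longrightarrow> \<bar>x\<bar> ^ k * norm (nth_derivative m g x) \<le>
        N * (fact k * (\<sigma> + 1 / 2) ^ k * exp (- \<psi>s (real k)))"
    using G_estimate[OF g zero_less_one, of "Suc n"] by meson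
  define D where "D = N * gain 1 * exp (\<phi> ((\<sigma> + 1) * \<bar>Im z\<bar>))"
  have H: "norm (?H x) * (1 + x\<^sup>2) \<le> D" for x
    unfolding D_def by (rule kernel_integrand_decay[OF N zero_less_one v]) simp
  have H': "norm (?H' x) * (1 + x\<^sup>2) \<le> D" for x
    unfolding D_def by (rule kernel_integrand_decay[OF N zero_less_one v[OF order_refl]])
  have "(LINT x|lborel. ?H' x + (\<i> * z) * ?H x) = 0"
  proof (rule integral_derivative_eq_0[where H = ?H])
    fix x
    have "((\<lambda>w. exp (\<i> * w * z)) has_field_derivative (\<i> * z) * exp (\<i> * w * z)) (at w)" for w
      by (auto intro!: derivative_eq_intros)
    from has_vector_derivative_real_field[OF this]
    have "(?e has_vector_derivative (\<i> * z) * ?e x) (at x)" .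
    from has_vector_derivative_mult[OF C_class_has_derivative[OF G_spaceD(1)[OF g]] this]
    show "(?H has_vector_derivative ?H' x + (\<i> * z) * ?H x) (at x)"
      by (simp only: mult_ac add.commute)
    show "continuous_on UNIV (\<lambda>x. ?H' x + (\<i> * z) * ?H x)"
      by (rule continuous_on_add[OF continuous_kernel_integrand[OF g]
            continuous_on_mult[OF continuous_on_const continuous_kernel_integrand[OF g]]])
    have "norm (?H' x + (\<i> * z) * ?H x) * (1 + x\<^sup>2) \<le>
        (norm (?H' x) + norm z * norm (?H x)) * (1 + x\<^sup>2)"
      using norm_triangle_ineq[of "?H' x" "(\<i> * z) * ?H x"]
      by (intro mult_right_mono) (simp_all only: norm_mult norm_ii mult_1_left, simp)
    also have "\<dots> = norm (?H' x) * (1 + x\<^sup>2) + norm z * (norm (?H x) * (1 + x\<^sup>2))"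
      by (simp only: distrib_right mult.assoc)
    also have "\<dots> \<le> D + norm z * D"
      by (intro add_mono mult_left_mono H H' norm_ge_zero)
    finally show "norm (?H' x + (\<i> * z) * ?H x) * (1 + x\<^sup>2) \<le> D + norm z * D" .
    show "norm (?H x) * (1 + x\<^sup>2) \<le> D"
      by (rule H)
  qed
  moreover have "(LINT x|lborel. ?H' x + (\<i> * z) * ?H x) =
      (LINT x|lborel. ?H' x) + (\<i> * z) * (LINT x|lborel. ?H x)"
    by (subst Bochner_Integration.integral_add)
       (simp_all only: integrable_kernel[OF g] integrable_mult_right integral_mult_right_zero)
  ultimately show ?thesis
    by (simp only: eq_neg_iff_add_eq_0 add.commute)
qed

text \<open>
  Iterated integration by parts: each factor \<open>z\<close> costs one derivative of \<open>g\<close>, and the signs and powers of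
  \<open>\<i>\<close> disappear in the norm.
\<close>

lemma norm_power_kernel_integral:
  assumes g: "g \<in> G"
  shows "norm z ^ n * norm (LINT x|lborel. g x * exp (\<i> * of_real x * z)) =
      norm (LINT x|lborel. nth_derivative n g x * exp (\<i> * of_real x * z))"
proof (induction n)
  case 0
  then show ?case
    by simp
next
  case (Suc n)
  have "norm z ^ Suc n * norm (LINT x|lborel. g x * exp (\<i> * of_real x * z)) =
      norm ((\<i> * z) * (LINT x|lborel. nth_derivative n g x * exp (\<i> * of_real x * z)))"
    using Suc by (simp add: norm_mult mult.assoc)
  also have "\<dots> = norm (LINT x|lborel. nth_derivative (Suc n) g x * exp (\<i> * of_real x * z))"
    unfolding kernel_integral_by_parts[OF g] by (rule norm_minus_cancel)
  finally show ?case .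
qed

text \<open>
  Half of \<open>\<epsilon>\<close> is kept for the norm of \<open>g\<close>, the other half is spent on the dilation.
\<close>

lemma S_norm_inverse_fourier_le:
  assumes g: "g \<in> G" and \<epsilon>: "\<epsilon> > 0"
  shows "S_norm \<phi> \<sigma> \<epsilon> k (inverse_fourier g) \<le> ennreal (2 ^ k * gain \<epsilon>) * G_norm \<psi>s \<sigma> (\<epsilon> / 2) k g"
proof -
  obtain N where N: "N \<ge> 0" "G_norm \<psi>s \<sigma> (\<epsilon> / 2) k g = ennreal N"
    and v: "\<And>n x j. n \<le> k \<Longrightarrow> \<bar>x\<bar> ^ j * norm (nth_derivative n g x) \<le>
        N * (fact j * (\<sigma> + \<epsilon> / 2) ^ j * exp (- \<psi>s (real j)))"
    using G_estimate[OF g \<epsilon>, of k] by meson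
  have "S_norm \<phi> \<sigma> \<epsilon> k (inverse_fourier g) \<le> ennreal (2 ^ k * gain \<epsilon> * N)"
  proof (subst S_norm_le_iff, safe)
    fix z
    define I where "I = (LINT x|lborel. g x * exp (\<i> * of_real x * z))"
    define E where "E = N * gain \<epsilon> * exp (\<phi> ((\<sigma> + \<epsilon>) * \<bar>Im z\<bar>))"
    have le: "norm z ^ n * norm I \<le> pi * E" if "n \<le> k" for n
      unfolding I_def norm_power_kernel_integral[OF g] E_def
      by (rule quadratic_decay_integral(2)[OF continuous_kernel_integrand[OF g]
            kernel_integrand_decay[OF N(1) \<epsilon> v[OF that]]])
    have "norm I * (1 + norm z) ^ k \<le> norm I * (2 ^ k * (1 + norm z ^ k))"
      by (intro mult_left_mono one_plus_power_le) auto
    also have "\<dots> = 2 ^ k * (norm z ^ 0 * norm I + norm z ^ k * norm I)"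
      by (simp add: algebra_simps)
    also have "\<dots> \<le> 2 ^ k * (pi * E + pi * E)"
      by (intro mult_left_mono add_mono le) auto
    finally have "1 / (2 * pi) * (norm I * (1 + norm z) ^ k) \<le> 1 / (2 * pi) * (2 ^ k * (pi * E + pi * E))"
      by (intro mult_left_mono) auto
    also have "\<dots> = 2 ^ k * E"
      by (simp add: field_simps)
    finally show "norm (inverse_fourier g z) * (1 + norm z) ^ k \<le>
        2 ^ k * gain \<epsilon> * N * exp (\<phi> ((\<sigma> + \<epsilon>) * \<bar>Im z\<bar>))"
      by (simp add: inverse_fourier_def norm_mult norm_divide I_def E_def mult_ac)
  qed (use N gain_nonneg[OF \<epsilon>] in auto)
  then show ?thesis
    using N gain_nonneg[OF \<epsilon>] by (simp add: ennreal_mult)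
qed

text \<open>
  Expanding the kernel and integrating term by term gives an everywhere convergent power series. The
  interchange is justified by the same majorant as the exponential decay.
\<close>

lemma inverse_fourier_holomorphic:
  assumes g: "g \<in> G"
  shows "inverse_fourier g holomorphic_on UNIV"
proof -
  let ?f = "\<lambda>w k x. g x * ((\<i> * complex_of_real x * w) ^ k /\<^sub>R fact k)"
  define a where "a k = (LINT x|lborel. g x * ((\<i> * complex_of_real x) ^ k /\<^sub>R fact k))" for k
  define s h where "s = \<sigma> + 1 / 2" and "h = dilation 1"
  have s: "s > 0" and h: "h > 1"
    using \<sigma>_pos dilation_gt_1[of 1] by (auto simp: s_def h_def)
  obtain N where N: "N \<ge> 0" and v: "\<And>m x k. m \<le> (0::nat) \<Longrightarrow> \<bar>x\<bar> ^ k * norm (nth_derivative m g x) \<le>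
        N * (fact k * s ^ k * exp (- \<psi>s (real k)))"
    unfolding s_def using G_estimate[OF g zero_less_one, of 0] by meson
  have series: "(\<lambda>k. a k * w ^ k) sums (LINT x|lborel. g x * exp (\<i> * of_real x * w))" for w
  proof -
    define M where "M k = N * majorant s h k * exp (\<phi> (h * (s * norm w)))" for k
    have M: "summable M"
      unfolding M_def by (intro summable_mult2 summable_mult summable_majorant h)
    have term_le: "norm (?f w k x) * (1 + x\<^sup>2) \<le> M k" for k x
    proof -
      have "norm (g x) * (1 + x\<^sup>2) * ((\<bar>x\<bar> * norm w) ^ k / fact k) \<le> M k"
        unfolding M_def using v[of 0] by (intro exp_series_term_le N s h) auto
      moreover have "norm (?f w k x) = norm (g x) * ((\<bar>x\<bar> * norm w) ^ k / fact k)"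
        by (simp add: norm_mult norm_power divide_inverse mult_ac)
      ultimately show ?thesis
        by (simp only: mult_ac)
    qed
    have norm_le: "norm (?f w k x) \<le> M k" for k x
    proof -
      have "norm (?f w k x) * 1 \<le> norm (?f w k x) * (1 + x\<^sup>2)"
        by (intro mult_left_mono) auto
      with term_le[of x k] show ?thesis
        by linarith
    qed
    have cont: "continuous_on UNIV (?f w k)" for k
      using continuous_on_G_derivative[OF g, of 0]
      by (auto intro!: continuous_intros simp: scaleR_conv_of_real)
    have "(\<lambda>k. LINT x|lborel. ?f w k x) sums (LINT x|lborel. (\<Sum>k. ?f w k x))"
    proof (rule sums_integral)
      show "integrable lborel (?f w k)" for k
        by (rule quadratic_decay_integral(1)[OF cont term_le])
      show "AE x in lborel. summable (\<lambda>k. norm (?f w k x))"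
        by (intro AE_I2 summable_comparison_test'[OF M, of 0]) (simp only: real_norm_def abs_norm_cancel norm_le)
      show "summable (\<lambda>k. LINT x|lborel. norm (?f w k x))"
      proof (rule summable_comparison_test'[of "\<lambda>k. pi * M k" 0])
        show "summable (\<lambda>k. pi * M k)"
          by (intro summable_mult M)
        show "norm (LINT x|lborel. norm (?f w k x)) \<le> pi * M k" for k
          by (rule quadratic_decay_integral(2)) (simp_all only: real_norm_def abs_norm_cancel term_le cont continuous_on_norm)
      qed
    qed
    moreover have "(\<Sum>k. ?f w k x) = g x * exp (\<i> * of_real x * w)" for x
      by (rule sums_unique[symmetric]) (intro sums_mult exp_converges)
    moreover have "(LINT x|lborel. ?f w k x) = a k * w ^ k" for k
    proof -
      have "?f w k x = g x * ((\<i> * complex_of_real x) ^ k /\<^sub>R fact k) * w ^ k" for x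
        by (simp add: power_mult_distrib)
      then show ?thesis
        by (simp only: a_def integral_mult_left_zero)
    qed
    ultimately show ?thesis
      by (simp only:)
  qed
  have ball: "inverse_fourier g holomorphic_on ball 0 r" for r
  proof (rule power_series_holomorphic)
    show "(\<lambda>k. (1 / (2 * pi)) * a k * (w - 0) ^ k) sums inverse_fourier g w" for w
      using sums_mult[OF series[of w], of "1 / (2 * pi)"]
      by (simp only: inverse_fourier_def mult.assoc diff_zero)
  qed
  show ?thesis
    unfolding holomorphic_on_def
  proof
    fix z :: complex
    show "inverse_fourier g field_differentiable at z within UNIV"
      by (rule holomorphic_on_imp_differentiable_at[OF ball[of "norm z + 1"]]) auto
  qed
qed

lemma inverse_fourier_in_S:
  assumes "g \<in> G"
  shows "inverse_fourier g \<in> S"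
proof (rule S_spaceI)
  show "inverse_fourier g holomorphic_on UNIV"
    by (rule inverse_fourier_holomorphic[OF assms])
  fix \<epsilon> :: real and k assume \<epsilon>: "\<epsilon> > 0"
  obtain N where "G_norm \<psi>s \<sigma> (\<epsilon> / 2) k g = ennreal N"
    using G_estimate[OF assms \<epsilon>, of k] by meson
  then show "S_norm \<phi> \<sigma> \<epsilon> k (inverse_fourier g) < \<infinity>"
    using S_norm_inverse_fourier_le[OF assms \<epsilon>, of k]
    by (auto elim!: order.strict_trans1 simp: ennreal_mult_less_top)
qed

lemma inverse_fourier_diff:
  assumes "f \<in> G" "g \<in> G"
  shows "inverse_fourier (\<lambda>x. f x - g x) = (\<lambda>z. inverse_fourier f z - inverse_fourier g z)"
proof
  fix z
  show "inverse_fourier (\<lambda>x. f x - g x) z = inverse_fourier f z - inverse_fourier g z"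
    unfolding inverse_fourier_def left_diff_distrib right_diff_distrib[symmetric]
    using integrable_kernel[OF assms(1), of 0 z] integrable_kernel[OF assms(2), of 0 z] by simp
qed

lemma inverse_fourier_real:
  "2 * pi * inverse_fourier g (of_real a) = (LINT x|lborel. g x * iexp (a * x))"
  by (simp add: inverse_fourier_def mult_ac)

section \<open>Inversion\<close>

lemma fourier_inverse_fourier:
  assumes g: "g \<in> G"
  shows "fourier (inverse_fourier g) = g"
proof
  fix a
  let ?T = "inverse_fourier g"
  have hat: "(LINT x|lborel. g x * iexp (- (x * y))) = 2 * pi * ?T (of_real (- y))" for y
    unfolding inverse_fourier_real by (simp add: mult.commute)
  obtain N where "\<And>n x k. n \<le> (0::nat) \<Longrightarrow> \<bar>x\<bar> ^ k * norm (nth_derivative n g x) \<le>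
        N * (fact k * (\<sigma> + 1 / 2) ^ k * exp (- \<psi>s (real k)))"
    using G_estimate[OF g zero_less_one, of 0] by meson
  from this[of 0 _ 0] have bounded: "norm (g x) \<le> N * exp (- \<psi>s 0)" for x
    by simp
  have "integrable lborel (\<lambda>y. ?T (of_real y))"
    using integrable_S_real[OF inverse_fourier_in_S[OF g], of 0] by simp
  from lborel_integrable_real_affine[OF this, of "-1" 0]
  have int_hat: "integrable lborel (\<lambda>y. LINT x|lborel. g x * iexp (- (x * y)))"
    unfolding hat by (intro integrable_mult_right) simp
  have "2 * pi * g a = (LINT y|lborel. (LINT x|lborel. g x * iexp (- (x * y))) * iexp (a * y))"
    using continuous_on_G_derivative[OF g, of 0] integrable_kernel[OF g, of 0 0]
    by (intro fourier_inversion[symmetric, where B = "N * exp (- \<psi>s 0)"] bounded int_hat) simp_all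
  also have "\<dots> = 2 * pi * (LINT y|lborel. ?T (of_real (- y)) * iexp (a * y))"
    unfolding hat by (simp only: mult.assoc integral_mult_right_zero)
  also have "(LINT y|lborel. ?T (of_real (- y)) * iexp (a * y)) = fourier ?T a"
    unfolding fourier_eq by (subst lborel_integral_real_affine[of "-1" _ 0]) simp_all
  finally show "fourier ?T a = g a"
    by simp
qed

lemma inverse_fourier_fourier:
  assumes f: "f \<in> S"
  shows "inverse_fourier (fourier f) = f"
proof (rule entire_eqI_real)
  have G: "fourier f \<in> G"
    by (rule fourier_in_G[OF f])
  show "inverse_fourier (fourier f) holomorphic_on UNIV" "f holomorphic_on UNIV"
    by (rule inverse_fourier_holomorphic[OF G], rule S_spaceD(1)[OF f])
  fix a
  obtain N where "\<And>z. norm (f z) * (1 + norm z) ^ 0 \<le> N * exp (\<phi> ((\<sigma> + 1) * \<bar>Im z\<bar>))"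
    using S_spaceD(2)[OF f zero_less_one] by meson
  from this[of "of_real _"] have bounded: "norm (f (of_real x)) \<le> N * exp (\<phi> 0)" for x
    by simp
  have int_hat: "integrable lborel (\<lambda>y. LINT x|lborel. f (of_real x) * iexp (- (x * y)))"
    using integrable_kernel[OF G, of 0 0] by (simp add: fourier_eq mult.commute)
  have "2 * pi * inverse_fourier (fourier f) (of_real a) =
      (LINT y|lborel. (LINT x|lborel. f (of_real x) * iexp (- (x * y))) * iexp (a * y))"
    unfolding inverse_fourier_real by (simp add: fourier_eq mult.commute)
  also have "\<dots> = 2 * pi * f (of_real a)"
    using integrable_S_real[OF f, of 0]
    by (intro fourier_inversion[where B = "N * exp (\<phi> 0)"] bounded int_hat continuous_on_S_real f) simp
  finally show "inverse_fourier (fourier f) (of_real a) = f (of_real a)"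
    by simp
qed

section \<open>The isomorphism\<close>

lemma bij_betw_fourier: "bij_betw fourier S G"
  by (rule bij_betw_byWitness[where f' = inverse_fourier])
     (use inverse_fourier_fourier fourier_inverse_fourier fourier_in_G inverse_fourier_in_S in auto)

lemma S_norm_zero: "S_norm \<phi> \<sigma> \<epsilon> k (\<lambda>_. 0) = 0"
  by (simp add: S_norm_def)

lemma G_norm_zero:
  assumes "\<epsilon> > 0"
  shows "G_norm w \<sigma> \<epsilon> m (\<lambda>_. 0) = 0"
proof -
  have "nth_derivative n (\<lambda>_. 0) = (\<lambda>_. 0)" for n
    by (induction n) simp_all
  then show ?thesis
    using G_norm_le_iff[of 0 \<sigma> \<epsilon> w m "\<lambda>_. 0"] assms \<sigma>_pos by simp
qed

lemma continuous_map_fourier: "continuous_map (S_topology \<phi> \<sigma>) (G_topology \<psi>s \<sigma>) fourier"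
  unfolding S_topology_def G_topology_def
proof (rule continuous_map_seminorm_topology)
  show "{G_norm \<psi>s \<sigma> \<epsilon> m |\<epsilon> m. 0 < \<epsilon>} \<noteq> {}"
    using zero_less_one by blast
  fix q a b c assume "q \<in> {G_norm \<psi>s \<sigma> \<epsilon> m |\<epsilon> m. 0 < \<epsilon>}" and abc: "a \<in> G" "b \<in> G" "c \<in> G"
  then obtain \<epsilon> m where "q = G_norm \<psi>s \<sigma> \<epsilon> m" "\<epsilon> > 0"
    by blast
  then show "q (\<lambda>y. a y - c y) \<le> q (\<lambda>y. a y - b y) + q (\<lambda>y. b y - c y)"
    using G_norm_triangle[OF abc[THEN G_spaceD(1)]] \<sigma>_pos by simp
next
  fix q assume "q \<in> {G_norm \<psi>s \<sigma> \<epsilon> m |\<epsilon> m. 0 < \<epsilon>}"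
  then obtain \<epsilon> m where q: "q = G_norm \<psi>s \<sigma> \<epsilon> m" "\<epsilon> > 0"
    by blast
  have "\<forall>f\<in>S. q (fourier f) \<le> ennreal pi * S_norm \<phi> \<sigma> \<epsilon> (m + 2) f"
    using G_norm_fourier_le q by blast
  then show "\<exists>p\<in>{S_norm \<phi> \<sigma> \<epsilon> k |\<epsilon> k. 0 < \<epsilon>}. \<exists>C\<ge>0. \<forall>f\<in>S. q (fourier f) \<le> ennreal C * p f"
    using q(2) pi_ge_zero by blast
qed (use fourier_in_G S_diff fourier_diff S_norm_zero G_norm_zero in auto)

lemma continuous_map_inverse_fourier:
  "continuous_map (G_topology \<psi>s \<sigma>) (S_topology \<phi> \<sigma>) inverse_fourier"
  unfolding S_topology_def G_topology_def
proof (rule continuous_map_seminorm_topology)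
  show "{S_norm \<phi> \<sigma> \<epsilon> k |\<epsilon> k. 0 < \<epsilon>} \<noteq> {}"
    using zero_less_one by blast
  fix q a b c assume "q \<in> {S_norm \<phi> \<sigma> \<epsilon> k |\<epsilon> k. 0 < \<epsilon>}"
  then show "q (\<lambda>y. a y - c y) \<le> q (\<lambda>y. a y - b y) + q (\<lambda>y. b y - c y)"
    using S_norm_triangle by blast
next
  fix q assume "q \<in> {S_norm \<phi> \<sigma> \<epsilon> k |\<epsilon> k. 0 < \<epsilon>}"
  then obtain \<epsilon> k where q: "q = S_norm \<phi> \<sigma> \<epsilon> k" "\<epsilon> > 0"
    by blast
  have "\<forall>g\<in>G. q (inverse_fourier g) \<le> ennreal (2 ^ k * gain \<epsilon>) * G_norm \<psi>s \<sigma> (\<epsilon> / 2) k g"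
    using S_norm_inverse_fourier_le q by blast
  moreover have "2 ^ k * gain \<epsilon> \<ge> 0"
    using gain_nonneg q by simp
  ultimately show "\<exists>p\<in>{G_norm \<psi>s \<sigma> \<epsilon> m |\<epsilon> m. 0 < \<epsilon>}. \<exists>C\<ge>0. \<forall>g\<in>G. q (inverse_fourier g) \<le> ennreal C * p g"
    using q(2) half_gt_zero by blast
qed (use inverse_fourier_in_S G_diff inverse_fourier_diff S_norm_zero G_norm_zero in auto)

lemma continuous_map_inv_into_fourier:
  "continuous_map (G_topology \<psi>s \<sigma>) (S_topology \<phi> \<sigma>) (inv_into S fourier)"
proof (rule continuous_map_eq[OF continuous_map_inverse_fourier])
  fix g assume "g \<in> topspace (G_topology \<psi>s \<sigma>)"
  then have g: "g \<in> G"
    unfolding G_topology_def seminorm_topology_def topology_generated_by_topspace by auto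
  have "inv_into S fourier (fourier (inverse_fourier g)) = inverse_fourier g"
    by (rule inv_into_f_f[OF bij_betw_imp_inj_on[OF bij_betw_fourier] inverse_fourier_in_S[OF g]])
  then show "inverse_fourier g = inv_into S fourier g"
    by (simp add: fourier_inverse_fourier[OF g])
qed

end

theorem theorem3:
  fixes \<sigma> :: real and \<phi> :: "real \<Rightarrow> real"
  assumes "\<sigma> > 0"
    and "\<forall>x\<ge>0. \<phi> x \<ge> 0"
    and "mono_on {0..} \<phi>"
    and "continuous_on {0..} \<phi>"
    and "filterlim (\<lambda>x. \<phi> x / x) at_top at_top"
    and "\<forall>h>1. \<exists>K>0. \<forall>x\<ge>0. 2 * \<phi> x \<le> \<phi> (h * x) + K"
    and "convex_on {0..} (\<lambda>x. \<phi> (exp x))"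
  defines "S \<equiv> S_space \<phi> \<sigma>"
    and "G \<equiv> G_space (young_conjugate (psi \<phi>)) \<sigma>"
    and "TS \<equiv> S_topology \<phi> \<sigma>"
    and "TG \<equiv> G_topology (young_conjugate (psi \<phi>)) \<sigma>"
  shows "linear_on_set S fourier \<and> bij_betw fourier S G \<and>
         continuous_map TS TG fourier \<and> continuous_map TG TS (inv_into S fourier)"
proof -
  interpret superlinear_weight \<phi> \<sigma>
    using assms(1-3,5) by unfold_locales (auto simp: mono_on_def)
  show ?thesis
    unfolding S_def G_def TS_def TG_def
    by (intro conjI linear_fourier bij_betw_fourier continuous_map_fourier
        continuous_map_inv_into_fourier)
qed

end
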